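(* Let $(X,d,\mu)$ be a metric space with a doubling measure, with constants $c_\mu,D$ as in the context, and let $\eta>0$ be fixed. Fix a ball $B_0$ and let $\tau\ge1$. Assume that $0\le w\in L^1(\tau\widehat B_0)$ satisfies the local weak Gurov-Reshetnyak condition $$\frac1{\mu(B)}\int_B|w-w_B|\,d\mu\le\varepsilon\,w_{\tau B}$$ for every ball $B$ with $\tau B\subset\tau\widehat B_0$. If $\varepsilon>0$ is small enough depending on $\mu$ and $\tau$, then there exists $p(\varepsilon)>1$ such that whenever $1\le p<p(\varepsilon)$ we have $$\Big(\frac1{\mu(B)}\int_B|w-w_B|^p\,d\mu\Big)^{1/p}\lesssim\varepsilon\,w_{\tau\widehat B}$$ for every ball $B$ with $\tau\widehat B\subset\tau\widehat B_0$, and hence $w$ satisfies the weak reverse Hölder inequality $$\Big(\frac1{\mu(B)}\int_Bw^p\,d\mu\Big)^{1/p}\lesssim\frac1{\mu(\tau\widehat B)}\int_{\tau\widehat B}w\,d\mu$$ for every ball $B$ with $\tau\widehat B\subset\tau\widehat B_0$. Moreover, $p(\varepsilon)\to+\infty$ as $\varepsilon\to0^+$. Explicitly, for a constant $C_\mu\ge1$ depending only on $\mu$, one has $$p(\varepsilon)=\frac{\log(C_\mu^{-1}\,c_\mu\,\tau^D\,\varepsilon^{-1})}{\log(2\,c_\mu\max\{\tau,3\}^D)}\qquad\text{with}\qquad 0<\varepsilon<\frac1{2\,C_\mu}\min\Big\{1,\frac\tau3\Big\}^D.$$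
   Context: $(X,d,\mu)$ is a metric space with a Borel regular measure $\mu$ with $0<\mu(B)<\infty$ for all balls $B$, which is doubling: $\mu(2B)\le c\,\mu(B)$ for all balls $B$. A ball $B=B(x_B,r_B)=\{y\in X:d(y,x_B)<r_B\}$ is an open ball that comes with a center and a positive finite radius; $\lambda B:=B(x_B,\lambda r_B)$. Doubling implies that there are constants $c_\mu$ and $D>0$ (fixed) with $\frac{\mu(B')}{\mu(B)}\le c_\mu\big(\frac{r_{B'}}{r_B}\big)^D$ for every $B\subset B'$ with $r_B\le r_{B'}$. $\widehat B:=(1+\eta)B$, with $\eta>0$ a fixed (small) number. $w_B=\frac1{\mu(B)}\int_Bw\,d\mu$. The symbol $\lesssim$ means inequality up to a multiplicative constant. *)

theory Defs
  imports "HOL-Analysis.Analysis"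
begin

text \<open>
  A Borel regular measure is given on a sigma-algebra containing the Borel sets, not necessarily
  equal to it, so that both Borel measures and the restriction of a Borel regular outer
  measure to its Caratheodory-measurable sets are covered. The inclusion forces
  \<^term>\<open>space M = UNIV\<close>.
\<close>

definition borel_regular :: "'a::metric_space measure \<Rightarrow> bool" where
  "borel_regular M \<longleftrightarrow>
     sets borel \<subseteq> sets M \<and>
     (\<forall>A\<in>sets M. \<exists>B\<in>sets borel. A \<subseteq> B \<and> emeasure M B = emeasure M A)"

definition doubling_measure :: "'a::metric_space measure \<Rightarrow> bool" where
  "doubling_measure M \<longleftrightarrow>
     borel_regular M \<and>
     (\<forall>x r. 0 < r \<longrightarrow> 0 < emeasure M (ball x r) \<and> emeasure M (ball x r) < \<infinity>) \<and>
     (\<exists>c::real. \<forall>x r. 0 < r \<longrightarrow> measure M (ball x (2 * r)) \<le> c * measure M (ball x r))"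

text \<open>
  Balls carry a centre and a radius, since the underlying set of points need not determine them;
  inclusion between balls, however, is inclusion of point sets.
\<close>

definition growth_bound :: "'a::metric_space measure \<Rightarrow> real \<Rightarrow> real \<Rightarrow> bool" where
  "growth_bound M c D \<longleftrightarrow>
     (\<forall>x r y s. 0 < r \<longrightarrow> r \<le> s \<longrightarrow> ball x r \<subseteq> ball y s \<longrightarrow>
        measure M (ball y s) / measure M (ball x r) \<le> c * (s / r) powr D)"

definition average :: "'a measure \<Rightarrow> 'a set \<Rightarrow> ('a \<Rightarrow> real) \<Rightarrow> real" where
  "average M A f = (1 / measure M A) * (LINT x:A|M. f x)"

definition weak_gurov_reshetnyak ::
    "'a::metric_space measure \<Rightarrow> real \<Rightarrow> real \<Rightarrow> 'a set \<Rightarrow> ('a \<Rightarrow> real) \<Rightarrow> bool" where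
  "weak_gurov_reshetnyak M \<tau> \<epsilon> A w \<longleftrightarrow>
     (\<forall>x r. 0 < r \<longrightarrow> ball x (\<tau> * r) \<subseteq> A \<longrightarrow>
        average M (ball x r) (\<lambda>y. \<bar>w y - average M (ball x r) w\<bar>)
          \<le> \<epsilon> * average M (ball x (\<tau> * r)) w)"

end

theory Submission
  imports Defs
begin

text \<open>
  Fix a ball \<open>B\<close> and put \<open>f = \<bar>w - w\<^sub>B\<bar>\<close>. Vitali balls stopped at the level \<open>5 u / 4\<close> of the averages of
  \<open>f\<close> have small oscillation relative to \<open>\<epsilon> (u + w\<^sub>U)\<close>, where \<open>U = \<tau> (1 + \<eta>) B\<close>; hence on each of
  them \<open>f > 3 u / 2\<close> is rare while \<open>f > u\<close> is typical. This gives a good-lambda inequality between the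
  levels \<open>u\<close> and \<open>3 u / 2\<close>. It is iterated from the level \<open>u\<^sub>0 = L \<epsilon> w\<^sub>U\<close> upwards, so that the
  resulting bound carries the factor \<open>\<epsilon>\<close>. The stopping radii at the level \<open>(3/2)^k u\<^sub>0\<close> decay
  geometrically in \<open>k\<close>, so all balls of all generations stay inside \<open>(1 + \<eta>) B\<close>. Summing over the
  levels converges when \<open>2 powr p * C\<^sub>\<mu> * \<epsilon> \<le> 1\<close>, which is weaker than \<open>p < p(\<epsilon>)\<close>.
\<close>

subsection \<open>Covering and regularity in metric spaces\<close>

text \<open>The obstacle is enlargement. The condition controls a ball only through its
  \<open>\<tau>\<close>-dilate, and the Vitali selection replaces a ball by its triple, so a level
  set of \<open>f\<close> on one ball is controlled by a lower level set on a larger ball. No single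
  estimate can be iterated on \<open>B\<close> itself, and the margin \<open>\<eta>\<close> has to
  pay for all generations together. The payment is possible because the condition for
  \<open>(1 + \<eta>) B\<close> itself bounds the mean of \<open>f\<close> there by a multiple of
  \<open>\<epsilon> w\<^sub>U\<close>. Measure growth of order \<open>D\<close> then bounds the
  average of \<open>f\<close> over a ball of radius \<open>s\<close> by a multiple of
  \<open>\<epsilon> w\<^sub>U (r / s)^D\<close>. Raising the level by 3/2 therefore shrinks the
  possible stopping radii by the factor \<open>(2/3)^(1/D)\<close>, and these radii have a finite
  sum, made small by a large choice of \<open>L\<close>. Since \<open>f\<close> is measured from the
  same value \<open>w\<^sub>B\<close> in every generation, the estimates chain without any change of
  the mean. Only the centres have to be covered, so triples suffice; this is the origin of
  \<open>3 powr D\<close> in the constant.\<close>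

lemma vitali_centers:
  fixes N :: "'a::metric_space set" and \<rho> :: "'a \<Rightarrow> real"
  assumes pos: "\<And>y. y \<in> N \<Longrightarrow> 0 < \<rho> y" and bdd: "\<And>y. y \<in> N \<Longrightarrow> \<rho> y \<le> R"
  obtains S where "S \<subseteq> N" "disjoint_family_on (\<lambda>y. ball y (\<rho> y)) S"
    "N \<subseteq> (\<Union>y\<in>S. ball y (3 * \<rho> y))"
proof -
  define meets where "meets x y \<longleftrightarrow> ball x (\<rho> x) \<inter> ball y (\<rho> y) \<noteq> {}" for x y
  \<comment> \<open>Zorn's lemma is applied to the disjoint subfamilies such that every ball meeting the subfamily
    meets a member of at least half its radius. A ball of almost maximal radius among those that
    miss a maximal subfamily could be added to it.\<close>
  define good where "good S \<longleftrightarrow> S \<subseteq> N \<and> disjoint_family_on (\<lambda>y. ball y (\<rho> y)) S \<and>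
    (\<forall>x\<in>N. (\<exists>y\<in>S. meets x y) \<longrightarrow> (\<exists>y\<in>S. meets x y \<and> \<rho> x \<le> 2 * \<rho> y))" for S
  have "\<exists>S\<in>Collect good. \<forall>X\<in>Collect good. S \<subseteq> X \<longrightarrow> X = S"
  proof (rule subset_Zorn')
    fix \<C> assume ch: "subset.chain (Collect good) \<C>"
    then have g: "good S" if "S \<in> \<C>" for S
      using that by (auto simp: subset.chain_def)
    have "disjoint_family_on (\<lambda>y. ball y (\<rho> y)) (\<Union>\<C>)"
      unfolding disjoint_family_on_def
    proof (intro ballI impI)
      fix x y assume "x \<in> \<Union>\<C>" "y \<in> \<Union>\<C>" and ne: "x \<noteq> y"
      then obtain X Y where XY: "X \<in> \<C>" "Y \<in> \<C>" "x \<in> X" "y \<in> Y" by blast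
      with ch have "X \<subseteq> Y \<or> Y \<subseteq> X" by (auto simp: subset.chain_def)
      then obtain Z where "Z \<in> \<C>" "x \<in> Z" "y \<in> Z" using XY by blast
      with g ne show "ball x (\<rho> x) \<inter> ball y (\<rho> y) = {}"
        by (auto simp: good_def disjoint_family_on_def)
    qed
    moreover have "\<Union>\<C> \<subseteq> N" using g by (auto simp: good_def)
    moreover have "\<exists>y\<in>\<Union>\<C>. meets x y \<and> \<rho> x \<le> 2 * \<rho> y"
      if "x \<in> N" "\<exists>y\<in>\<Union>\<C>. meets x y" for x
      using that g unfolding good_def by (meson UnionI UnionE)
    ultimately show "\<Union>\<C> \<in> Collect good" by (simp add: good_def)
  qed
  then obtain S where S: "good S" and max: "\<And>X. good X \<Longrightarrow> S \<subseteq> X \<Longrightarrow> X = S" by auto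
  have touch: "\<exists>y\<in>S. meets x y" if "x \<in> N" for x
  proof (rule ccontr)
    define T where "T = {x\<in>N. \<forall>y\<in>S. \<not> meets x y}"
    assume "\<not> (\<exists>y\<in>S. meets x y)"
    with that have "x \<in> T" by (auto simp: T_def)
    have TN: "T \<subseteq> N" by (auto simp: T_def)
    have bT: "bdd_above (\<rho> ` T)" using bdd TN by (auto simp: bdd_above_def)
    have "0 < (SUP y\<in>T. \<rho> y)"
      using pos[OF that] cSUP_upper[OF \<open>x \<in> T\<close> bT] by linarith
    then have "(SUP y\<in>T. \<rho> y) / 2 < (SUP y\<in>T. \<rho> y)" by simp
    then obtain z where z: "z \<in> T" "(SUP y\<in>T. \<rho> y) / 2 < \<rho> z"
      using \<open>x \<in> T\<close> bT less_cSUP_iff[of T \<rho>] by blast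
    have big: "\<rho> v \<le> 2 * \<rho> z" if "v \<in> T" for v
      using cSUP_upper[OF that bT] z by linarith
    have "good (insert z S)"
      unfolding good_def
    proof (intro conjI ballI impI)
      show "insert z S \<subseteq> N" using z S TN by (auto simp: good_def)
      show "disjoint_family_on (\<lambda>y. ball y (\<rho> y)) (insert z S)"
        using z S unfolding good_def T_def meets_def disjoint_family_on_def by blast
      fix v assume v: "v \<in> N" "\<exists>y\<in>insert z S. meets v y"
      show "\<exists>y\<in>insert z S. meets v y \<and> \<rho> v \<le> 2 * \<rho> y"
      proof (cases "\<exists>y\<in>S. meets v y")
        case True
        then show ?thesis using S v unfolding good_def by blast
      next
        case False
        then have "v \<in> T" using v by (auto simp: T_def)
        with big v False show ?thesis by blast
      qed
    qed
    then have "z \<in> S" using max by blast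
    then have "\<not> meets z z" using z by (auto simp: T_def)
    then have "\<rho> z \<le> 0" by (auto simp: meets_def)
    then show False using pos[of z] z TN by auto
  qed
  have "N \<subseteq> (\<Union>y\<in>S. ball y (3 * \<rho> y))"
  proof
    fix x assume "x \<in> N"
    with touch S obtain y where y: "y \<in> S" "meets x y" "\<rho> x \<le> 2 * \<rho> y"
      unfolding good_def by blast
    then obtain z where "dist x z < \<rho> x" "dist y z < \<rho> y" by (auto simp: meets_def)
    then have "dist y x < 3 * \<rho> y" using y(3) dist_triangle[of y x z] by (simp add: dist_commute)
    with y show "x \<in> (\<Union>y\<in>S. ball y (3 * \<rho> y))" by auto
  qed
  with S that show ?thesis by (auto simp: good_def)
qed

lemma emeasure_UN_le_countable:
  assumes S: "countable S"
    and P: "\<And>y. y \<in> S \<Longrightarrow> P y \<in> sets M" and T: "\<And>y. y \<in> S \<Longrightarrow> T y \<in> sets M"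
    and disj: "disjoint_family_on T S"
    and le: "\<And>y. y \<in> S \<Longrightarrow> emeasure M (P y) \<le> k * emeasure M (T y)"
  shows "emeasure M (\<Union>y\<in>S. P y) \<le> k * emeasure M (\<Union>y\<in>S. T y)"
proof -
  define h where "h = to_nat_on S"
  define g where "g = from_nat_into S"
  define ext :: "('a \<Rightarrow> 'b set) \<Rightarrow> nat \<Rightarrow> 'b set"
    where "ext A n = (if n \<in> h ` S then A (g n) else {})" for A n
  have gh: "g (h y) = y" if "y \<in> S" for y
    using that S by (simp add: g_def h_def)
  have un: "(\<Union>n. ext A n) = (\<Union>y\<in>S. A y)" for A
    by (auto simp: ext_def gh split: if_splits)
  have m: "ext P n \<in> sets M" "ext T n \<in> sets M" for n
    using P T by (auto simp: ext_def gh)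
  have "disjoint_family (ext T)"
    using disj unfolding disjoint_family_on_def ext_def
    by (auto simp: gh) (metis IntI empty_iff)
  then have eq: "(\<Sum>n. emeasure M (ext T n)) = emeasure M (\<Union>n. ext T n)"
    using m by (intro suminf_emeasure) auto
  have "emeasure M (\<Union>n. ext P n) \<le> (\<Sum>n. emeasure M (ext P n))"
    using m by (intro emeasure_subadditive_countably) auto
  also have "\<dots> \<le> (\<Sum>n. k * emeasure M (ext T n))"
    using le by (intro suminf_le) (auto simp: ext_def gh)
  also have "\<dots> = k * emeasure M (\<Union>n. ext T n)"
    by (simp add: eq)
  finally show ?thesis by (simp add: un)
qed

text \<open>The space is not assumed separable, so countability of a Vitali family comes from the
  measure: finite subfamilies have total measure at most that of \<open>V\<close>, and a summable
  family has only countably many nonzero terms.\<close>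

lemma countable_disjoint_positive_measure:
  assumes T: "\<And>y. y \<in> S \<Longrightarrow> T y \<in> sets M" "\<And>y. y \<in> S \<Longrightarrow> T y \<subseteq> V"
    and pos: "\<And>y. y \<in> S \<Longrightarrow> 0 < measure M (T y)"
    and V: "V \<in> sets M" "emeasure M V < \<infinity>" and disj: "disjoint_family_on T S"
  shows "countable S"
proof -
  have fin: "emeasure M (T y) \<noteq> \<infinity>" if "y \<in> S" for y
    using emeasure_mono[OF T(2) V(1), OF that] V(2) by (auto simp: top_unique)
  have "sum (\<lambda>y. measure M (T y)) F \<le> measure M V" if "F \<subseteq> S" "finite F" for F
  proof -
    have d: "disjoint_family_on T F" using disj that by (auto simp: disjoint_family_on_def)
    have "sum (\<lambda>y. measure M (T y)) F = measure M (\<Union>y\<in>F. T y)"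
      using that T fin d by (intro measure_finite_Union[symmetric]) auto
    also have "\<dots> \<le> measure M V"
      using that T V by (intro measure_mono_fmeasurable) (auto simp: fmeasurable_def)
    finally show ?thesis .
  qed
  then have "(\<lambda>y. measure M (T y)) summable_on S"
    by (intro nonneg_bdd_above_summable_on) (auto simp: bdd_above_def)
  then have "countable {y\<in>S. measure M (T y) \<noteq> 0}"
    by (rule summable_countable_real)
  moreover have "{y\<in>S. measure M (T y) \<noteq> 0} = S" using pos by force
  ultimately show ?thesis by simp
qed

text \<open>Induction over the generation of the Borel sets from the open ones. Approximating by
  closed sets from inside and open sets from outside at the same time makes the claim symmetric
  under complements; measuring the error inside \<open>V\<close> makes continuity from above
  available.\<close>

lemma borel_approx_open_closed:
  fixes M :: "'a::metric_space measure"
  assumes sb: "sets borel \<subseteq> sets M" and V: "V \<in> sets M" "emeasure M V < \<infinity>"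
    and E: "E \<in> sets borel" and e: "0 < (e::real)"
  shows "\<exists>F U. closed F \<and> open U \<and> F \<subseteq> E \<and> E \<subseteq> U \<and> measure M ((U - F) \<inter> V) < e"
proof -
  have Vf: "V \<in> fmeasurable M" using V by (simp add: fmeasurable_def)
  have fm: "A \<inter> V \<in> fmeasurable M" if "A \<in> sets M" for A
    using that V Vf by (metis fmeasurable_Int_fmeasurable inf_commute)
  have oc: "open A \<Longrightarrow> A \<in> sets M" "closed A \<Longrightarrow> A \<in> sets M" for A
    using sb borel_open borel_closed by blast+
  have "E \<in> sigma_sets UNIV {S. open S}"
    using E by (simp add: borel_def)
  then show ?thesis using e
  proof (induction arbitrary: e rule: sigma_sets.induct)
    case (Basic A)
    then have oA: "open A" by simp
    \<comment> \<open>\<open>F n\<close> holds the points at distance at least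
      \<open>1 / Suc n\<close> from every point outside \<open>A\<close>; these closed sets exhaust
      the open set \<open>A\<close>.\<close>
    define F where "F n = - (\<Union>x\<in>-A. ball x (1 / Suc n))" for n :: nat
    have cl: "closed (F n)" for n unfolding F_def by (intro closed_Compl open_UN) auto
    have FA: "F n \<subseteq> A" for n by (force simp: F_def)
    have un: "(\<Inter>n. (A - F n) \<inter> V) = {}"
    proof -
      have "\<exists>n. x \<in> F n" if x: "x \<in> A" for x
      proof -
        obtain d where d: "0 < d" "ball x d \<subseteq> A" using oA x openE by blast
        obtain n where "1 / real (Suc n) < d" using nat_approx_posE d(1) by blast
        then have "x \<in> F n" using d(2) by (force simp: F_def dist_commute)
        then show ?thesis ..
      qed
      then show ?thesis by blast
    qed
    have decr: "decseq (\<lambda>n. (A - F n) \<inter> V)"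
    proof (rule decseq_SucI)
      fix n
      have "F n \<subseteq> F (Suc n)"
      proof -
        have "ball x (1 / Suc (Suc n)) \<subseteq> ball x (1 / Suc n)" for x :: 'a
          by (intro subset_ball) (simp add: field_simps)
        then show ?thesis by (auto simp: F_def)
      qed
      then show "(A - F (Suc n)) \<inter> V \<subseteq> (A - F n) \<inter> V" by blast
    qed
    have mf: "(A - F n) \<inter> V \<in> fmeasurable M" for n
      by (intro fm sets.Diff oc oA cl)
    have "(\<lambda>n. measure M ((A - F n) \<inter> V)) \<longlonglongrightarrow> measure M (\<Inter>n. (A - F n) \<inter> V)"
      using mf decr by (intro Lim_measure_decseq) (auto dest: fmeasurableD2)
    then have "(\<lambda>n. measure M ((A - F n) \<inter> V)) \<longlonglongrightarrow> 0"
      unfolding un by simp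
    then obtain n where "measure M ((A - F n) \<inter> V) < e"
      using order_tendstoD(2)[OF _ Basic.prems] eventually_sequentially by fastforce
    then show ?case using cl oA FA by blast
  next
    case Empty
    then show ?case by (intro exI[of _ "{}"]) auto
  next
    case (Compl A)
    from Compl.IH[OF Compl.prems] obtain F U where "closed F" "open U" "F \<subseteq> A" "A \<subseteq> U"
      "measure M ((U - F) \<inter> V) < e" by blast
    moreover have "- F - (- U) = U - F" by blast
    ultimately show ?case by (intro exI[of _ "- U"] exI[of _ "- F"]) auto
  next
    case (Union A)
    have "\<exists>F U. closed F \<and> open U \<and> F \<subseteq> A n \<and> A n \<subseteq> U \<and> measure M ((U - F) \<inter> V) < e/2 * (1/2)^Suc n" for n
      using Union.IH[of "e/2 * (1/2)^Suc n" n] Union.prems by simp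
    then obtain F U where FU: "\<And>n. closed (F n)" "\<And>n. open (U n)" "\<And>n. F n \<subseteq> A n"
      "\<And>n. A n \<subseteq> U n" "\<And>n. measure M ((U n - F n) \<inter> V) < e/2 * (1/2)^Suc n"
      by metis
    have m1: "(U n - F n) \<inter> V \<in> fmeasurable M" for n
      using FU by (intro fm sets.Diff oc) auto
    have mF: "(\<Union>n. F n) \<in> sets M" using FU oc by (intro sets.countable_UN) auto
    have geo: "(\<lambda>n. e/2 * (1/2)^Suc n) sums (e/2)"
      using sums_mult[OF power_half_series, of "e/2"] by simp
    have sm: "summable (\<lambda>n. measure M ((U n - F n) \<inter> V))"
      using FU(5) by (intro summable_comparison_test'[OF sums_summable[OF geo]]) (auto intro: less_imp_le)
    have lt: "emeasure M (\<Union>n. (U n - F n) \<inter> V) < \<infinity>"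
      and "emeasure M (\<Union>n. (U n - F n) \<inter> V) \<le> (\<Sum>n. measure M ((U n - F n) \<inter> V))"
      using m1 sm by (intro emeasure_union_summable; auto simp: fmeasurable_def)+
    then have "measure M (\<Union>n. (U n - F n) \<inter> V) \<le> (\<Sum>n. measure M ((U n - F n) \<inter> V))"
      using suminf_nonneg[OF sm] lt by (simp add: measure_def enn2real_leI)
    also have "\<dots> \<le> e/2"
      using FU(5) by (intro sums_le[OF _ summable_sums[OF sm] geo]) (auto intro: less_imp_le)
    finally have h1: "measure M (\<Union>n. (U n - F n) \<inter> V) \<le> e/2" .
    have "(\<Union>n. (U n - F n) \<inter> V) \<in> sets M"
      using m1 by (intro sets.countable_UN) (auto dest: fmeasurableD)
    then have fUn: "(\<Union>n. (U n - F n) \<inter> V) \<in> fmeasurable M"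
      using lt by (simp only: fmeasurable_def mem_Collect_eq)
    \<comment> \<open>The union of all \<open>F i\<close> need not be closed, so a finite union is
      taken. \<open>R n\<close> is what it misses inside \<open>V\<close>; its measure tends to 0
      and uses the second half of \<open>e\<close>.\<close>
    define R where "R n = ((\<Union>n. F n) - (\<Union>i\<le>n. F i)) \<inter> V" for n
    have mR: "R n \<in> fmeasurable M" for n
      unfolding R_def by (intro fm sets.Diff[OF mF] sets.finite_UN) (auto intro: oc FU)
    have "(\<lambda>n. measure M (R n)) \<longlonglongrightarrow> measure M (\<Inter>n. R n)"
    proof (rule Lim_measure_decseq)
      show "range R \<subseteq> sets M" using mR by auto
      show "decseq R" unfolding R_def decseq_def by (fastforce dest: order_trans)
      show "emeasure M (R n) \<noteq> \<infinity>" for n using fmeasurableD2[OF mR] by simp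
    qed
    moreover have "(\<Inter>n. R n) = {}" by (auto simp: R_def)
    ultimately have "(\<lambda>n. measure M (R n)) \<longlonglongrightarrow> 0" by simp
    then obtain n where n: "measure M (R n) < e/2"
      using order_tendstoD(2)[of _ 0 _ "e/2"] Union.prems eventually_sequentially by fastforce
    define F' where "F' = (\<Union>i\<le>n. F i)"
    have F': "closed F'" unfolding F'_def using FU by (intro closed_UN) auto
    have U': "open (\<Union>n. U n)" using FU by auto
    have "((\<Union>n. U n) - F') \<inter> V \<subseteq> (\<Union>n. (U n - F n) \<inter> V) \<union> R n"
      by (auto simp: F'_def R_def)
    then have "measure M (((\<Union>n. U n) - F') \<inter> V) \<le> measure M ((\<Union>n. (U n - F n) \<inter> V) \<union> R n)"
      using mR fm[of "(\<Union>n. U n) - F'"] U' F' oc fUn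
      by (intro measure_mono_fmeasurable fmeasurable.Un) auto
    also have "\<dots> \<le> measure M (\<Union>n. (U n - F n) \<inter> V) + measure M (R n)"
      using fUn mR by (intro measure_Un_le) (auto dest: fmeasurableD)
    also have "\<dots> < e" using h1 n by linarith
    finally have "measure M (((\<Union>n. U n) - F') \<inter> V) < e" .
    moreover have "F' \<subseteq> (\<Union>n. A n)" "(\<Union>n. A n) \<subseteq> (\<Union>n. U n)"
      using FU by (auto simp: F'_def) blast+
    ultimately show ?case using F' U' by blast
  qed
qed

section \<open>Set integrals, averages and Markov's inequality\<close>

lemma set_integrable_const_fmeasurable:
  "A \<in> fmeasurable M \<Longrightarrow> set_integrable M A (\<lambda>_. k :: real)"
  by (auto simp: set_integrable_def fmeasurable_def intro!: integrable_mult_left)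

lemma set_integral_const_fmeasurable:
  "A \<in> fmeasurable M \<Longrightarrow> (LINT y:A|M. k) = k * measure M A" for k :: real
  by (subst set_integral_const) (auto simp: fmeasurableD2)

lemma markov_set:
  fixes g :: "'a \<Rightarrow> real"
  assumes g: "set_integrable M A g" "\<And>y. y \<in> A \<Longrightarrow> 0 \<le> g y" and A: "A \<in> fmeasurable M"
    and T: "T \<in> sets M" "T \<subseteq> A" "\<And>y. y \<in> T \<Longrightarrow> s \<le> g y"
  shows "s * measure M T \<le> (LINT y:A|M. g y)"
proof -
  have Tf: "T \<in> fmeasurable M" using A T by (meson fmeasurableI2)
  have gT: "set_integrable M T g" using set_integrable_subset g T by blast
  have "s * measure M T = (LINT y:T|M. s)"
    using Tf by (simp add: set_integral_const fmeasurableD2 less_top)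
  also have "\<dots> \<le> (LINT y:T|M. g y)"
    using gT T Tf by (intro set_integral_mono set_integrable_const_fmeasurable) auto
  also have "\<dots> \<le> (LINT y:A|M. g y)"
    unfolding set_lebesgue_integral_def
    using g gT T by (intro integral_mono) (auto simp: set_integrable_def indicator_def)
  finally show ?thesis .
qed

lemma average_mult_measure:
  "0 < measure M A \<Longrightarrow> average M A g * measure M A = (LINT y:A|M. g y)"
  by (simp add: average_def)

lemma average_le_iff:
  "0 < measure M A \<Longrightarrow> average M A g \<le> k \<longleftrightarrow> (LINT y:A|M. g y) \<le> k * measure M A"
  by (simp add: average_def pos_divide_le_eq)

lemma less_average_iff:
  "0 < measure M A \<Longrightarrow> k < average M A g \<longleftrightarrow> k * measure M A < (LINT y:A|M. g y)"
  by (simp add: average_def pos_less_divide_eq)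

lemma average_cong: "(\<And>y. y \<in> A \<Longrightarrow> g y = h y) \<Longrightarrow> average M A g = average M A h"
  unfolding average_def set_lebesgue_integral_def
  by (intro arg_cong2[where f = times] refl Bochner_Integration.integral_cong) (auto simp: indicator_def)

lemma average_nonneg: "AE v in M. 0 \<le> g v \<Longrightarrow> 0 \<le> average M A g"
  unfolding average_def set_lebesgue_integral_def
  by (intro mult_nonneg_nonneg integral_nonneg_AE) (auto elim!: eventually_mono)

lemma set_integrable_if_integrable:
  fixes w :: "'a \<Rightarrow> real"
  shows "integrable M w \<Longrightarrow> A \<in> sets M \<Longrightarrow> set_integrable M A w"
  using integrable_mult_indicator[of A M w] by (simp add: set_integrable_def)

lemma set_integrable_dev:
  fixes w :: "'a \<Rightarrow> real"
  assumes "integrable M w" "A \<in> fmeasurable M"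
  shows "set_integrable M A (\<lambda>v. w v - k)" "set_integrable M A (\<lambda>v. \<bar>w v - k\<bar>)"
  using assms set_integrable_if_integrable
  by (auto intro!: set_integrable_abs set_integral_diff set_integrable_const_fmeasurable)

lemma set_integral_mono_superset:
  fixes g :: "'a \<Rightarrow> real"
  assumes "set_integrable M B g" "A \<in> sets M" "A \<subseteq> B" "AE v in M. v \<in> B \<longrightarrow> 0 \<le> g v"
  shows "(LINT y:A|M. g y) \<le> (LINT y:B|M. g y)"
proof -
  have "set_integrable M A g" using assms set_integrable_subset by blast
  with assms show ?thesis
    unfolding set_lebesgue_integral_def set_integrable_def
    by (intro integral_mono_AE) (auto simp: indicator_def elim!: eventually_mono)
qed

lemma abs_average_diff_le:
  fixes w :: "'a \<Rightarrow> real"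
  assumes w: "integrable M w" and A: "A \<in> fmeasurable M" "0 < measure M A"
  shows "\<bar>average M A w - k\<bar> \<le> average M A (\<lambda>v. \<bar>w v - k\<bar>)"
proof -
  have "(average M A w - k) * measure M A = (LINT v:A|M. w v - k)"
    using w A set_integrable_if_integrable[OF w, of A] average_mult_measure[of M A w]
    by (subst set_integral_diff(2))
      (auto simp: set_integrable_const_fmeasurable set_integral_const_fmeasurable left_diff_distrib)
  then have "\<bar>average M A w - k\<bar> * measure M A = \<bar>LINT v:A|M. w v - k\<bar>"
    by (metis abs_mult abs_of_pos A(2))
  also have "\<dots> \<le> (LINT v:A|M. \<bar>w v - k\<bar>)"
    unfolding set_lebesgue_integral_def
    using integral_abs_bound[of M "\<lambda>v. indicator A v *\<^sub>R (w v - k)"] by (simp add: abs_mult)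
  finally show ?thesis using A by (simp add: average_def pos_le_divide_eq)
qed

lemma average_subset:
  assumes "A \<in> sets M" "B \<in> fmeasurable M" "A \<subseteq> B" "0 < measure M A"
    and "set_integrable M B g" "AE v in M. 0 \<le> g v"
  shows "average M A g * measure M A \<le> average M B g * measure M B"
proof -
  have "0 < measure M B" using assms measure_mono_fmeasurable[of A B M] by auto
  moreover have "AE v in M. v \<in> B \<longrightarrow> 0 \<le> g v" using assms(6) by (auto elim: eventually_mono)
  ultimately show ?thesis
    using assms set_integral_mono_superset[of M B g A] by (simp add: average_mult_measure)
qed

lemma powr_inverse_le:
  assumes "X \<le> Y powr p" "0 \<le> X" "0 \<le> Y" "1 \<le> (p::real)"
  shows "X powr (1 / p) \<le> Y"
proof -
  have "X powr (1 / p) \<le> (Y powr p) powr (1 / p)" using assms by (intro powr_mono2) auto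
  also have "\<dots> = Y" using assms by (simp add: powr_powr)
  finally show ?thesis .
qed

section \<open>Vitali covering, outer regularity and small averages under measure growth\<close>

locale doubling_space =
  fixes M :: "'a::metric_space measure" and c D :: real
  assumes regular: "borel_regular M"
    and ball_pos: "0 < r \<Longrightarrow> 0 < emeasure M (ball x r)"
    and ball_fin: "0 < r \<Longrightarrow> emeasure M (ball x r) < \<infinity>"
    and D_pos: "0 < D"
    and growth: "growth_bound M c D"
begin

lemma sets_borel: "A \<in> sets borel \<Longrightarrow> A \<in> sets M"
  using regular by (auto simp: borel_regular_def)

lemma sets_ball [measurable, simp]: "ball x r \<in> sets M"
  by (intro sets_borel) auto

lemma space_UNIV [simp]: "space M = UNIV"
  using sets_borel[of UNIV] sets.sets_into_space[of UNIV M] by auto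

lemma fmeasurable_ball [simp]: "ball x r \<in> fmeasurable M"
proof (cases "0 < r")
  case True
  then show ?thesis using ball_fin by (simp add: fmeasurable_def)
qed (simp add: not_less ball_empty)

lemma emeasure_ball_finite [simp]: "emeasure M (ball x r) < \<infinity>"
  using fmeasurable_ball[of x r] by (simp only: fmeasurable_def mem_Collect_eq)

lemma measure_ball_pos: "0 < r \<Longrightarrow> 0 < measure M (ball x r)"
  using ball_pos ball_fin by (simp add: measure_def enn2real_positive_iff)

lemma measure_ball_le:
  assumes "0 < r" "r \<le> s" "ball x r \<subseteq> ball y s"
  shows "measure M (ball y s) \<le> c * (s / r) powr D * measure M (ball x r)"
  using growth assms measure_ball_pos[OF assms(1), of x]
  unfolding growth_bound_def by (metis pos_divide_le_eq)

lemma c_ge_1: "1 \<le> c"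
  using measure_ball_le[of 1 1 undefined undefined] measure_ball_pos[of 1 undefined] by simp

lemma measure_ball_triple:
  assumes "0 < r"
  shows "measure M (ball x (3 * r)) \<le> c * 3 powr D * measure M (ball x r)"
  using measure_ball_le[of r "3 * r" x x] assms by (simp add: subset_ball)

text \<open>Turns an estimate on single balls into a global one. Each \<open>T y\<close> sits inside
  the ball at \<open>y\<close>, so on the selected centres the sets \<open>T y\<close> are disjoint
  and the constant \<open>k\<close> survives the summation without an overlap factor.\<close>

lemma vitali_measure:
  fixes \<rho> :: "'a \<Rightarrow> real"
  assumes \<rho>: "\<And>y. y \<in> N \<Longrightarrow> 0 < \<rho> y" "\<And>y. y \<in> N \<Longrightarrow> ball y (\<rho> y) \<subseteq> ball z s"
      "\<And>y. y \<in> N \<Longrightarrow> \<rho> y \<le> R"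
    and P: "\<And>y. y \<in> N \<Longrightarrow> P y \<in> sets M"
    and T: "\<And>y. y \<in> N \<Longrightarrow> T y \<in> sets M" "\<And>y. y \<in> N \<Longrightarrow> T y \<subseteq> ball y (\<rho> y)"
      "\<And>y. y \<in> N \<Longrightarrow> T y \<subseteq> T0" and T0: "T0 \<in> sets M"
    and le: "\<And>y. y \<in> N \<Longrightarrow> emeasure M (P y) \<le> k * emeasure M (T y)"
  obtains S where "countable S" "S \<subseteq> N" "N \<subseteq> (\<Union>y\<in>S. ball y (3 * \<rho> y))"
    "(\<Union>y\<in>S. P y) \<in> sets M" "emeasure M (\<Union>y\<in>S. P y) \<le> k * emeasure M T0"
proof -
  from vitali_centers[of N \<rho> R] \<rho> obtain S where S: "S \<subseteq> N"
    and disj: "disjoint_family_on (\<lambda>y. ball y (\<rho> y)) S"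
    and cov: "N \<subseteq> (\<Union>y\<in>S. ball y (3 * \<rho> y))" by metis
  have cnt: "countable S"
    using S \<rho> by (intro countable_disjoint_positive_measure[OF _ _ _ _ _ disj, of M "ball z s"])
      (auto intro!: measure_ball_pos simp del: infinity_ennreal_def)
  have "disjoint_family_on T S"
    using disj T(2) S unfolding disjoint_family_on_def by blast
  then have "emeasure M (\<Union>y\<in>S. P y) \<le> k * emeasure M (\<Union>y\<in>S. T y)"
    using S P T le by (intro emeasure_UN_le_countable cnt) auto
  also have "\<dots> \<le> k * emeasure M T0"
    using T(3) S T0 by (intro mult_left_mono emeasure_mono UN_least) auto
  finally show ?thesis using that cnt S cov P by (auto intro!: sets.countable_UN'')
qed

text \<open>Borel regularity gives a Borel hull \<open>H\<close> of the same measure. As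
  \<open>E\<close> has finite measure, \<open>H - E\<close> is null, so the approximation of Borel
  sets passes to every measurable \<open>E\<close> inside a ball.\<close>

lemma outer_regular:
  assumes E: "E \<in> sets M" "E \<subseteq> ball z s" and e: "0 < (e::real)"
  obtains U where "open U" "E \<subseteq> U" "U \<subseteq> ball z s" "measure M (U - E) < e"
proof -
  obtain H where H: "H \<in> sets borel" "E \<subseteq> H" "emeasure M H = emeasure M E"
    using regular E by (auto simp: borel_regular_def)
  define V where "V = ball z s"
  have "H \<inter> V \<in> sets borel" using H by (simp add: V_def)
  then obtain F U where FU: "open U" "closed F" "F \<subseteq> H \<inter> V" "H \<inter> V \<subseteq> U" "measure M ((U - F) \<inter> V) < e"
    using borel_approx_open_closed[of M V "H \<inter> V" e] regular e
    by (auto simp: borel_regular_def V_def simp del: infinity_ennreal_def; blast)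
  have Ef: "E \<in> fmeasurable M" using E by (meson fmeasurable_ball fmeasurableI2)
  then have "emeasure M E \<noteq> \<infinity>" by (simp add: fmeasurableD2)
  then have null: "emeasure M (H - E) = 0"
    using H E by (subst emeasure_Diff) (auto simp: sets_borel)
  have m: "U \<in> sets M" "F \<in> sets M" "H \<in> sets M"
    using FU H by (auto intro: sets_borel)
  have fm: "A \<inter> V \<in> fmeasurable M" if "A \<in> sets M" for A
    using that by (metis V_def fmeasurable_ball fmeasurable_Int_fmeasurable inf_commute)
  have n: "H - E \<in> null_sets M" using null m E by auto
  have "measure M (U \<inter> V - E) \<le> measure M ((U - F) \<inter> V \<union> (H - E))"
    using FU m n E fm[of "U - F"] by (intro measure_mono_fmeasurable fmeasurable.Un)
      (auto simp: fmeasurable_def null_setsD1 V_def)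
  also have "\<dots> \<le> measure M ((U - F) \<inter> V) + measure M (H - E)"
    using m E by (intro measure_Un_le) (auto simp: V_def)
  also have "measure M (H - E) = 0" using null by (simp add: measure_def)
  finally have "measure M (U \<inter> V - E) < e" using FU by simp
  moreover have "E \<subseteq> U \<inter> V" using E H FU by (auto simp: V_def)
  ultimately show ?thesis using FU that[of "U \<inter> V"] by (auto simp: V_def)
qed

text \<open>
  A one-sided substitute for the Lebesgue differentiation theorem. It needs only the Vitali
  selection and outer regularity, and \<open>N\<close> itself need not be measurable.
\<close>

lemma null_set_small_averages:
  fixes f :: "'a \<Rightarrow> real"
  assumes f: "set_integrable M (ball z s) f" "\<And>y. 0 \<le> f y" "f \<in> borel_measurable M"
    and t: "0 \<le> t" "t < t'" and \<rho>: "0 < \<rho>"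
    and N: "N \<subseteq> ball z s" "\<And>y. y \<in> N \<Longrightarrow> t' < f y"
      "\<And>y a. y \<in> N \<Longrightarrow> 0 < a \<Longrightarrow> a \<le> \<rho> \<Longrightarrow> (LINT v:ball y a|M. f v) \<le> t * measure M (ball y a)"
  shows "\<exists>Z\<in>null_sets M. N \<subseteq> Z"
proof -
  define E where "E = {y \<in> ball z s. t' < f y}"
  have E: "E \<in> sets M" "E \<subseteq> ball z s"
  proof -
    have "{y \<in> space M. t' < f y} \<in> sets M" using f(3) by measurable
    then have "ball z s \<inter> {y \<in> space M. t' < f y} \<in> sets M" by (intro sets.Int) auto
    moreover have "ball z s \<inter> {y \<in> space M. t' < f y} = E" by (auto simp: E_def)
    ultimately show "E \<in> sets M" by simp
  qed (auto simp: E_def)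
  define k where "k = c * 3 powr D / (1 - t / t')"
  have tt: "0 < 1 - t / t'" using t by simp
  have k0: "0 \<le> k" using c_ge_1 tt by (simp add: k_def)
  \<comment> \<open>\<open>N\<close> gets measurable covers of arbitrarily small measure;
    intersecting those for \<open>e = 1 / Suc n\<close> gives the null set.\<close>
  have cover: "\<exists>P\<in>sets M. N \<subseteq> P \<and> emeasure M P \<le> ennreal (k * e)" if e: "0 < e" for e :: real
  proof -
    obtain U where U: "open U" "E \<subseteq> U" "U \<subseteq> ball z s" "measure M (U - E) < e"
      using outer_regular[OF E e] by blast
    have UM: "U \<in> sets M" using U by (auto intro: sets_borel)
    have NE: "N \<subseteq> E" using N by (auto simp: E_def)
    have "\<exists>a. 0 < a \<and> a \<le> \<rho> \<and> ball y a \<subseteq> U" if "y \<in> N" for y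
    proof -
      have "y \<in> U" using that NE U by auto
      then obtain a where "0 < a" "ball y a \<subseteq> U" using U openE by blast
      then show ?thesis using \<rho> by (intro exI[of _ "min a \<rho>"]) auto
    qed
    then obtain \<sigma> where \<sigma>: "\<And>y. y \<in> N \<Longrightarrow> 0 < \<sigma> y \<and> \<sigma> y \<le> \<rho> \<and> ball y (\<sigma> y) \<subseteq> U" by metis
    \<comment> \<open>By Markov's inequality \<open>E\<close> fills at most the fraction
      \<open>t / t'\<close> of the ball, so the ball is comparable to its part outside
      \<open>E\<close>. For the selected balls these parts are disjoint and lie in
      \<open>U - E\<close>, whose measure is below \<open>e\<close>.\<close>
    have main: "emeasure M (ball y (3 * \<sigma> y)) \<le> ennreal k * emeasure M (ball y (\<sigma> y) - E)" if y: "y \<in> N" for y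
    proof -
      define b where "b = ball y (\<sigma> y)"
      have bf: "b \<in> fmeasurable M" by (simp add: b_def)
      have bE: "b \<inter> E \<in> fmeasurable M" "b - E \<in> fmeasurable M" using bf E
        by (auto intro: fmeasurable_Int_fmeasurable fmeasurable_Diff)
      have bs: "b \<subseteq> ball z s" using \<sigma>[OF y] U by (auto simp: b_def)
      have "t' * measure M (b \<inter> E) \<le> (LINT v:b|M. f v)"
        using f bs bE by (intro markov_set[OF _ _ bf] set_integrable_subset[OF f(1)])
          (auto simp: E_def b_def)
      also have "\<dots> \<le> t * measure M b" using N(3)[OF y] \<sigma>[OF y] by (simp add: b_def)
      finally have "measure M (b \<inter> E) \<le> t / t' * measure M b"
        using t by (simp add: field_simps)
      moreover have "measure M b = measure M (b \<inter> E) + measure M (b - E)"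
        using bE measure_Union[of M "b \<inter> E" "b - E"]
        by (auto simp: Int_Diff_Un fmeasurableD2 fmeasurableD)
      ultimately have "(1 - t / t') * measure M b \<le> measure M (b - E)"
        by (simp add: algebra_simps)
      then have "measure M b \<le> measure M (b - E) / (1 - t / t')"
        using tt by (simp add: pos_le_divide_eq mult.commute)
      then have "c * 3 powr D * measure M b \<le> c * 3 powr D * (measure M (b - E) / (1 - t / t'))"
        using c_ge_1 by (intro mult_left_mono) auto
      also have "\<dots> = k * measure M (b - E)" by (simp add: k_def)
      finally have "measure M (ball y (3 * \<sigma> y)) \<le> k * measure M (b - E)"
        using measure_ball_triple[of "\<sigma> y" y] \<sigma>[OF y] by (simp add: b_def)
      then show ?thesis
        using bE k0 unfolding b_def
        by (simp add: emeasure_eq_measure2 flip: ennreal_mult)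
    qed
    have "\<exists>S. countable S \<and> S \<subseteq> N \<and> N \<subseteq> (\<Union>y\<in>S. ball y (3 * \<sigma> y)) \<and>
      (\<Union>y\<in>S. ball y (3 * \<sigma> y)) \<in> sets M \<and>
      emeasure M (\<Union>y\<in>S. ball y (3 * \<sigma> y)) \<le> ennreal k * emeasure M (U - E)"
      by (rule vitali_measure[of N \<sigma> z s \<rho> "\<lambda>y. ball y (3 * \<sigma> y)" "\<lambda>y. ball y (\<sigma> y) - E" "U - E" "ennreal k"])
        (use \<sigma> U UM E main in \<open>auto, blast?\<close>)
    then obtain S where S: "N \<subseteq> (\<Union>y\<in>S. ball y (3 * \<sigma> y))" "(\<Union>y\<in>S. ball y (3 * \<sigma> y)) \<in> sets M"
      "emeasure M (\<Union>y\<in>S. ball y (3 * \<sigma> y)) \<le> ennreal k * emeasure M (U - E)" by blast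
    have "U - E \<in> fmeasurable M"
      using U UM E by (intro fmeasurableI2[OF fmeasurable_ball[of z s]]) auto
    then have "ennreal k * emeasure M (U - E) = ennreal (k * measure M (U - E))"
      using k0 by (simp add: emeasure_eq_measure2 flip: ennreal_mult)
    also have "\<dots> \<le> ennreal (k * e)" using U k0 by (intro ennreal_leI mult_left_mono) auto
    finally show ?thesis using S by (intro bexI[of _ "\<Union>y\<in>S. ball y (3 * \<sigma> y)"]) auto
  qed
  then have "\<exists>P\<in>sets M. N \<subseteq> P \<and> emeasure M P \<le> ennreal (k * (1 / real (Suc n)))" for n
    using cover[of "1 / real (Suc n)"] by simp
  then obtain P where P: "\<And>n. P n \<in> sets M" "\<And>n. N \<subseteq> P n"
    "\<And>n. emeasure M (P n) \<le> ennreal (k * (1 / real (Suc n)))" by metis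
  define Z where "Z = (\<Inter>n. P n)"
  have "Z \<in> sets M" using P by (auto simp: Z_def)
  moreover have "emeasure M Z \<le> 0"
  proof (rule LIMSEQ_le_const[OF _ exI, OF _ allI, OF _ impI])
    show "(\<lambda>n. ennreal (k * (1 / real (Suc n)))) \<longlonglongrightarrow> 0"
      using tendsto_ennrealI[OF tendsto_mult_right_zero[OF lim_1_over_n[THEN LIMSEQ_Suc]], of k] by simp
    show "emeasure M Z \<le> ennreal (k * (1 / real (Suc n)))" for n
      using P by (intro order_trans[OF emeasure_mono[of Z "P n" M]]) (auto simp: Z_def)
  qed
  ultimately have "Z \<in> null_sets M" by auto
  moreover have "N \<subseteq> Z" using P by (auto simp: Z_def)
  ultimately show ?thesis by blast
qed

subsection \<open>The good-lambda inequality\<close>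

text \<open>Let \<open>q\<close> be the mean of \<open>w\<close> over the tripled ball. The
  hypotheses \<open>up\<close> and \<open>low\<close> pin \<open>\<bar>q - a\<bar>\<close> between
  \<open>t - C1 * e\<close> and \<open>t\<close>. A deviation from \<open>a\<close> above
  \<open>t + s\<close> on the triple, or at most \<open>t - s\<close> on the small ball, therefore
  forces \<open>w\<close> away from \<open>q\<close>, and the oscillation bound makes both events
  rare.\<close>

lemma good_lambda_ball:
  fixes w :: "'a \<Rightarrow> real"
  assumes w: "integrable M w" and \<rho>: "0 < \<rho>"
    and osc: "average M (ball y (3 * \<rho>)) (\<lambda>v. \<bar>w v - average M (ball y (3 * \<rho>)) w\<bar>) \<le> e"
    and up: "average M (ball y (3 * \<rho>)) (\<lambda>v. \<bar>w v - a\<bar>) \<le> t"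
    and low: "t < average M (ball y \<rho>) (\<lambda>v. \<bar>w v - a\<bar>)"
    and s: "0 < s" "3 * (c * 3 powr D) * e \<le> s"
  shows "measure M ({v. t + s < \<bar>w v - a\<bar>} \<inter> ball y (3 * \<rho>))
    \<le> 2 * (c * 3 powr D) * e / s * measure M ({v. t - s < \<bar>w v - a\<bar>} \<inter> ball y \<rho>)"
proof -
  define Q b C1 where "Q = ball y (3 * \<rho>)" and "b = ball y \<rho>" and "C1 = c * 3 powr D"
  define q where "q = average M Q w"
  define m where "m = \<bar>q - a\<bar>"
  have C1: "0 \<le> C1" using c_ge_1 by (simp add: C1_def)
  have pos: "0 < measure M Q" "0 < measure M b" using \<rho> by (auto simp: Q_def b_def measure_ball_pos)
  have fm: "Q \<in> fmeasurable M" "b \<in> fmeasurable M" "Q \<in> sets M" "b \<in> sets M" by (auto simp: Q_def b_def)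
  have bQ: "b \<subseteq> Q" using \<rho> by (auto simp: Q_def b_def)
  have Qb: "measure M Q \<le> C1 * measure M b"
    using measure_ball_triple[OF \<rho>, of y] by (simp add: Q_def b_def C1_def)
  have I: "(LINT v:Q|M. \<bar>w v - q\<bar>) \<le> e * measure M Q"
    using osc pos by (simp add: average_le_iff Q_def q_def)
  have "0 \<le> (LINT v:Q|M. \<bar>w v - q\<bar>)"
    unfolding set_lebesgue_integral_def by (intro integral_nonneg_AE) auto
  with I pos have e: "0 \<le> e" by (meson linorder_not_le mult_neg_pos order_trans)
  have eQ: "e * measure M Q \<le> C1 * e * measure M b"
    using mult_left_mono[OF Qb e] by (simp add: algebra_simps)
  have wm[measurable]: "w \<in> borel_measurable M" using w by auto
  have set: "{v. P (w v)} \<inter> A \<in> sets M" if "Measurable.pred borel P" "A \<in> sets M" for P A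
  proof -
    have "{v \<in> space M. P (w v)} \<in> sets M" using that(1) by measurable
    then show ?thesis using that(2) by (auto intro: sets.Int)
  qed
  have m_le: "m \<le> t"
    using abs_average_diff_le[OF w fm(1) pos(1), of a] up by (simp add: m_def q_def Q_def)
  have "s * measure M ({v. t + s < \<bar>w v - a\<bar>} \<inter> Q) \<le> (LINT v:Q|M. \<bar>w v - q\<bar>)"
    using m_le by (intro markov_set set_integrable_dev w fm set) (auto simp: m_def)
  also note I
  also note eQ
  finally have 1: "measure M ({v. t + s < \<bar>w v - a\<bar>} \<inter> Q) \<le> C1 * e / s * measure M b"
    using s by (simp add: field_simps)
  have Ib: "(LINT v:b|M. \<bar>w v - q\<bar>) \<le> C1 * e * measure M b"
    using set_integral_mono_superset[of M Q "\<lambda>v. \<bar>w v - q\<bar>" b] set_integrable_dev[OF w fm(1)] fm bQ I eQ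
    by (auto dest: fmeasurableD)
  have "t * measure M b < (LINT v:b|M. \<bar>w v - a\<bar>)"
    using low pos by (simp add: less_average_iff b_def)
  also have "\<dots> \<le> (LINT v:b|M. \<bar>w v - q\<bar> + m)"
    by (intro set_integral_mono set_integral_add set_integrable_dev w fm set_integrable_const_fmeasurable)
      (auto simp: m_def)
  also have "\<dots> = (LINT v:b|M. \<bar>w v - q\<bar>) + m * measure M b"
    using set_integrable_dev[OF w fm(2)] fm
    by (subst set_integral_add(2)) (auto simp: set_integrable_const_fmeasurable set_integral_const_fmeasurable)
  also have "\<dots> \<le> (C1 * e + m) * measure M b" using Ib by (simp add: algebra_simps)
  finally have m_gt: "t - C1 * e < m" using pos by simp
  have Cs: "3 * (C1 * e) \<le> s" using s by (simp add: C1_def algebra_simps)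
  \<comment> \<open>On this set \<open>\<bar>w - q\<bar>\<close> is at least
    \<open>s - C1 * e\<close>, hence at least \<open>2 * s / 3\<close>, while its integral over
    \<open>b\<close> is at most \<open>s / 3 * measure M b\<close>. So the set takes up at most half
    of \<open>b\<close>.\<close>
  have "(s - C1 * e) * measure M ({v. \<bar>w v - a\<bar> \<le> t - s} \<inter> b) \<le> (LINT v:b|M. \<bar>w v - q\<bar>)"
    using m_gt by (intro markov_set set_integrable_dev w fm set) (auto simp: m_def)
  also note Ib
  also have "C1 * e * measure M b \<le> (s / 3) * measure M b" using Cs pos by (intro mult_right_mono) auto
  finally have 2: "(s - C1 * e) * measure M ({v. \<bar>w v - a\<bar> \<le> t - s} \<inter> b) \<le> s / 3 * measure M b" .
  have "(2 * s / 3) * measure M ({v. \<bar>w v - a\<bar> \<le> t - s} \<inter> b)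
      \<le> (s - C1 * e) * measure M ({v. \<bar>w v - a\<bar> \<le> t - s} \<inter> b)"
    using Cs by (intro mult_right_mono) auto
  with 2 have "2 * s / 3 * measure M ({v. \<bar>w v - a\<bar> \<le> t - s} \<inter> b) \<le> s / 3 * measure M b" by linarith
  then have "s / 3 * (2 * measure M ({v. \<bar>w v - a\<bar> \<le> t - s} \<inter> b)) \<le> s / 3 * measure M b"
    by simp
  then have 3: "2 * measure M ({v. \<bar>w v - a\<bar> \<le> t - s} \<inter> b) \<le> measure M b"
    using s by (subst (asm) mult_le_cancel_left_pos) auto
  have "measure M b \<le> measure M ({v. \<bar>w v - a\<bar> \<le> t - s} \<inter> b \<union> {v. t - s < \<bar>w v - a\<bar>} \<inter> b)"
    using fm by (intro measure_mono_fmeasurable fmeasurable.Un fmeasurableI2[OF fm(2)] set) auto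
  also have "\<dots> \<le> measure M ({v. \<bar>w v - a\<bar> \<le> t - s} \<inter> b) + measure M ({v. t - s < \<bar>w v - a\<bar>} \<inter> b)"
    using fm by (intro measure_Un_le set) auto
  finally have "measure M b \<le> 2 * measure M ({v. t - s < \<bar>w v - a\<bar>} \<inter> b)" using 3 by linarith
  then have "C1 * e / s * measure M b \<le> C1 * e / s * (2 * measure M ({v. t - s < \<bar>w v - a\<bar>} \<inter> b))"
    using C1 e s by (intro mult_left_mono) auto
  with 1 show ?thesis by (simp add: Q_def b_def C1_def algebra_simps)
qed

end

text \<open>\<open>\<Lambda>\<close> replaces the mean of \<open>w\<close> over
  \<open>\<tau> (1 + \<eta>) B\<close> by a strictly positive upper bound, so that all levels are
  positive even when that mean is 0. It is lowered to the mean only after the final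
  estimate.\<close>

locale gr_ball = doubling_space M c D for M :: "'a::metric_space measure" and c D :: real +
  fixes w :: "'a \<Rightarrow> real" and x :: 'a and r \<tau> \<eta> \<epsilon> \<Lambda> :: real
  assumes w_int: "integrable M w" and w_nonneg: "AE v in M. 0 \<le> w v"
    and params: "0 < r" "1 \<le> \<tau>" "0 < \<eta>" "0 < \<epsilon>" "0 < \<Lambda>"
    and gr: "weak_gurov_reshetnyak M \<tau> \<epsilon> (ball x (\<tau> * ((1 + \<eta>) * r))) w"
    and \<Lambda>: "average M (ball x (\<tau> * ((1 + \<eta>) * r))) w \<le> \<Lambda>"
begin

definition "a = average M (ball x r) w"
definition "f v = \<bar>w v - a\<bar>"
definition "K1 = 1 + c * (1 + \<eta>) powr D"
definition "K2 = c * (\<tau> * (1 + \<eta>)) powr D"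

lemma r_le: "r \<le> (1 + \<eta>) * r" "(1 + \<eta>) * r \<le> \<tau> * ((1 + \<eta>) * r)"
  using params mult_right_mono[of 1 "1 + \<eta>" r] mult_right_mono[of 1 \<tau> "(1 + \<eta>) * r"] by auto

lemma f_int: "A \<in> fmeasurable M \<Longrightarrow> set_integrable M A f"
  using set_integrable_dev[OF w_int] by (simp add: f_def[abs_def])

lemma f_meas [measurable]: "f \<in> borel_measurable M"
  using w_int unfolding f_def[abs_def] by measurable

lemma f_nonneg: "0 \<le> f v" by (simp add: f_def)

lemma level_set [simp]: "{v. t < f v} \<inter> ball y s \<in> sets M"
proof -
  have "{v \<in> space M. t < f v} \<in> sets M" by measurable
  then show ?thesis by (auto intro: sets.Int)
qed

lemma level_set_fmeasurable [simp]: "{v. t < f v} \<inter> ball y s \<in> fmeasurable M"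
  by (rule fmeasurableI2[OF fmeasurable_ball[of y s]]) auto

lemma a_nonneg: "0 \<le> a"
  unfolding a_def by (rule average_nonneg[OF w_nonneg])

text \<open>Since \<open>w\<close> is nonnegative almost everywhere, passing from \<open>B\<close>
  to the ball of radius \<open>\<tau> * ((1 + \<eta>) * r)\<close> costs only the ratio of the
  measures, which is \<open>K2\<close>.\<close>

lemma a_le: "a \<le> K2 * \<Lambda>"
proof -
  define U where "U = ball x (\<tau> * ((1 + \<eta>) * r))"
  have rU: "r \<le> \<tau> * ((1 + \<eta>) * r)" using r_le by linarith
  have sub: "ball x r \<subseteq> U" unfolding U_def using rU by (rule subset_ball)
  have "a * measure M (ball x r) \<le> average M U w * measure M U"
    unfolding a_def using sub params
    by (intro average_subset w_nonneg set_integrable_if_integrable w_int measure_ball_pos) (auto simp: U_def)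
  also have "\<dots> \<le> \<Lambda> * (c * (\<tau> * ((1 + \<eta>) * r) / r) powr D * measure M (ball x r))"
    using \<Lambda> measure_ball_le[OF params(1) rU] sub params by (intro mult_mono) (auto simp: U_def)
  also have "\<dots> = K2 * \<Lambda> * measure M (ball x r)"
    using params by (simp add: K2_def)
  finally show ?thesis using measure_ball_pos[of r x] params by simp
qed

lemma gr_le:
  assumes "0 < s" "ball y (\<tau> * s) \<subseteq> ball x (\<tau> * ((1 + \<eta>) * r))"
  shows "average M (ball y s) (\<lambda>v. \<bar>w v - average M (ball y s) w\<bar>) \<le> \<epsilon> * average M (ball y (\<tau> * s)) w"
  using gr assms by (simp add: weak_gurov_reshetnyak_def)

text \<open>Source of the factor \<open>\<epsilon>\<close> in the base level. The condition is
  applied to \<open>(1 + \<eta>) B\<close>, whose \<open>\<tau>\<close>-dilate is exactly the ball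
  on which it is assumed. Replacing the mean over that ball by \<open>a\<close> costs the second
  summand of \<open>K1\<close>.\<close>

lemma integral_f_le: "(LINT v:ball x ((1 + \<eta>) * r)|M. f v) \<le> K1 * \<epsilon> * \<Lambda> * measure M (ball x ((1 + \<eta>) * r))"
proof -
  define V B where "V = ball x ((1 + \<eta>) * r)" and "B = ball x r"
  define q where "q = average M V w"
  define I where "I = average M V (\<lambda>v. \<bar>w v - q\<bar>)"
  have pos: "0 < measure M V" "0 < measure M B"
    using params by (auto simp: V_def B_def intro!: measure_ball_pos)
  have fm: "V \<in> fmeasurable M" "B \<in> fmeasurable M" by (auto simp: V_def B_def)
  have sub: "B \<subseteq> V" unfolding V_def B_def using r_le by (intro subset_ball) auto
  have "I \<le> \<epsilon> * average M (ball x (\<tau> * ((1 + \<eta>) * r))) w"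
    unfolding I_def q_def V_def using params by (intro gr_le) auto
  also have "\<dots> \<le> \<epsilon> * \<Lambda>" using \<Lambda> params by (intro mult_left_mono) auto
  finally have I: "I \<le> \<epsilon> * \<Lambda>" .
  have VB: "measure M V \<le> c * (1 + \<eta>) powr D * measure M B"
    using measure_ball_le[OF params(1) r_le(1), of x x] sub params by (simp add: V_def B_def)
  have I0: "0 \<le> I" unfolding I_def by (rule average_nonneg) auto
  have "\<bar>a - q\<bar> \<le> average M B (\<lambda>v. \<bar>w v - q\<bar>)"
    unfolding a_def B_def[symmetric] by (rule abs_average_diff_le[OF w_int fm(2) pos(2)])
  then have "\<bar>a - q\<bar> * measure M B \<le> average M B (\<lambda>v. \<bar>w v - q\<bar>) * measure M B"
    using pos by (intro mult_right_mono) auto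
  also have "\<dots> \<le> I * measure M V"
    unfolding I_def using fm sub pos by (intro average_subset set_integrable_dev w_int) auto
  also have "\<dots> \<le> I * (c * (1 + \<eta>) powr D * measure M B)"
    using VB I0 by (rule mult_left_mono)
  finally have "\<bar>a - q\<bar> * measure M B \<le> (c * (1 + \<eta>) powr D * I) * measure M B"
    by (simp add: algebra_simps)
  then have q: "\<bar>q - a\<bar> \<le> c * (1 + \<eta>) powr D * I"
    using pos by (simp add: abs_minus_commute)
  have "(LINT v:V|M. f v) \<le> (LINT v:V|M. \<bar>w v - q\<bar> + \<bar>q - a\<bar>)"
    by (intro set_integral_mono set_integral_add set_integrable_dev w_int fm f_int set_integrable_const_fmeasurable)
      (auto simp: f_def)
  also have "\<dots> = (LINT v:V|M. \<bar>w v - q\<bar>) + \<bar>q - a\<bar> * measure M V"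
    using set_integrable_dev[OF w_int fm(1)] fm
    by (subst set_integral_add(2)) (auto simp: set_integrable_const_fmeasurable set_integral_const_fmeasurable)
  also have "(LINT v:V|M. \<bar>w v - q\<bar>) = I * measure M V"
    unfolding I_def using pos by (simp add: average_mult_measure)
  also have "I * measure M V + \<bar>q - a\<bar> * measure M V \<le> (K1 * I) * measure M V"
    using mult_right_mono[OF q, of "measure M V"] by (simp add: K1_def algebra_simps)
  also have "\<dots> \<le> (K1 * (\<epsilon> * \<Lambda>)) * measure M V"
    using I c_ge_1 by (intro mult_right_mono mult_left_mono) (auto simp: K1_def)
  finally show ?thesis by (simp add: V_def algebra_simps)
qed

lemma average_f_small_ball:
  assumes y: "ball y s \<subseteq> ball x ((1 + \<eta>) * r)" and s: "0 < s" "s \<le> (1 + \<eta>) * r"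
  shows "average M (ball y s) f \<le> K1 * c * ((1 + \<eta>) * r / s) powr D * (\<epsilon> * \<Lambda>)"
proof -
  have "(LINT v:ball y s|M. f v) \<le> (LINT v:ball x ((1 + \<eta>) * r)|M. f v)"
    using y f_nonneg by (intro set_integral_mono_superset f_int) auto
  also note integral_f_le
  also have "K1 * \<epsilon> * \<Lambda> * measure M (ball x ((1 + \<eta>) * r))
     \<le> K1 * \<epsilon> * \<Lambda> * (c * ((1 + \<eta>) * r / s) powr D * measure M (ball y s))"
    using measure_ball_le[OF s y] params c_ge_1 by (intro mult_left_mono) (auto simp: K1_def)
  finally show ?thesis
    using measure_ball_pos[OF s(1), of y] by (simp add: average_le_iff algebra_simps)
qed

text \<open>The hypothesis \<open>small\<close> forces every stopping radius to be at most
  \<open>\<sigma>\<close>, so stopping balls centred in the ball of radius \<open>r2\<close> stay in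
  that of radius \<open>r1\<close>. The bound on \<open>3 * \<tau> * \<sigma>\<close> keeps even the
  \<open>\<tau>\<close>-dilates of their triples inside \<open>(1 + \<eta>) B\<close>, where the
  condition applies.\<close>

lemma good_lambda_step:
  assumes u: "0 < u" and \<sigma>: "0 < \<sigma>" "3 * \<tau> * \<sigma> \<le> \<eta> * r / 2"
    and r: "r2 + \<sigma> \<le> r1" "r1 \<le> (1 + \<eta> / 2) * r"
    and small: "\<And>y s. dist x y < (1 + \<eta> / 2) * r \<Longrightarrow> \<sigma> < s \<Longrightarrow> s \<le> \<eta> * r / 2 \<Longrightarrow> average M (ball y s) f \<le> u"
    and e: "e = \<epsilon> * (5 / 4 * u + K2 * \<Lambda>)" "3 * (c * 3 powr D) * e \<le> u / 4"
  shows "measure M ({v. 3 / 2 * u < f v} \<inter> ball x r2)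
    \<le> 8 * (c * 3 powr D) * e / u * measure M ({v. u < f v} \<inter> ball x r1)"
proof -
  define h where "h = \<eta> * r / 2"
  define t where "t = 5 / 4 * u"
  define V where "V = ball x ((1 + \<eta>) * r)"
  define G where "G = {v. 3 / 2 * u < f v} \<inter> ball x r2"
  define k where "k = 8 * (c * 3 powr D) * e / u"
  have h: "0 < h" using params by (simp add: h_def)
  have e0: "0 \<le> e" using params c_ge_1 u by (simp add: e K2_def)
  have k0: "0 \<le> k" using e0 c_ge_1 u by (simp add: k_def)
  have \<sigma>h: "3 * \<tau> * \<sigma> \<le> h" "3 * \<sigma> \<le> h" "\<sigma> \<le> h"
  proof -
    show 1: "3 * \<tau> * \<sigma> \<le> h" using \<sigma> by (simp add: h_def)
    have "1 * (3 * \<sigma>) \<le> \<tau> * (3 * \<sigma>)" using params \<sigma> by (intro mult_right_mono) auto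
    then show "3 * \<sigma> \<le> h" using 1 by (simp add: algebra_simps)
    then show "\<sigma> \<le> h" using \<sigma> by linarith
  qed
  have sub: "ball y s \<subseteq> V" if "dist x y < (1 + \<eta> / 2) * r" "s \<le> h" for y s
  proof
    fix v assume "v \<in> ball y s"
    then have "dist x v < (1 + \<eta> / 2) * r + h"
      using that dist_triangle[of x v y] by simp
    then show "v \<in> V" by (simp add: V_def h_def algebra_simps)
  qed
  have VU: "V \<subseteq> ball x (\<tau> * ((1 + \<eta>) * r))"
    unfolding V_def using r_le by (intro subset_ball) auto
  have Gd: "dist x y < (1 + \<eta> / 2) * r" if "y \<in> G" for y
    using that r \<sigma> by (auto simp: G_def)
  define N where "N = {y \<in> G. \<forall>s. 0 < s \<longrightarrow> s \<le> h \<longrightarrow> average M (ball y s) f \<le> t}"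
  have "\<exists>Z\<in>null_sets M. N \<subseteq> Z"
  proof (rule null_set_small_averages[of x "(1 + \<eta>) * r" f t "3 / 2 * u" h N])
    show "N \<subseteq> ball x ((1 + \<eta>) * r)"
    proof
      fix y assume "y \<in> N"
      then have "dist x y < (1 + \<eta> / 2) * r" by (intro Gd) (simp add: N_def)
      from sub[OF this order_refl] h show "y \<in> ball x ((1 + \<eta>) * r)"
        unfolding V_def by (meson centre_in_ball subsetD)
    qed
    show "3 / 2 * u < f y" if "y \<in> N" for y using that by (simp add: N_def G_def)
    show "(LINT v:ball y s|M. f v) \<le> t * measure M (ball y s)" if "y \<in> N" "0 < s" "s \<le> h" for y s
    proof -
      have "average M (ball y s) f \<le> t" using that by (simp add: N_def)
      then show ?thesis using average_le_iff[OF measure_ball_pos[OF that(2)]] by blast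
    qed
    show "0 \<le> t" "t < 3 / 2 * u" using u by (simp_all add: t_def)
  qed (use h in \<open>simp_all add: f_int f_nonneg\<close>)
  then obtain Z where Z: "Z \<in> null_sets M" "N \<subseteq> Z" by blast
  have "\<exists>s. 0 < s \<and> s \<le> \<sigma> \<and> t < average M (ball y s) f \<and>
      (\<forall>s'. 2 * s \<le> s' \<longrightarrow> s' \<le> h \<longrightarrow> average M (ball y s') f \<le> t)" if y: "y \<in> G - Z" for y
  proof -
    \<comment> \<open>The supremum of \<open>S\<close> need not be attained. An element
      \<open>s\<close> above half of it is enough: all radii from \<open>2 * s\<close> up to
      \<open>h\<close> lie outside \<open>S\<close>, and \<open>3 * s\<close> and
      \<open>\<tau> * (3 * s)\<close> are among them.\<close>
    define S where "S = {s. 0 < s \<and> s \<le> h \<and> t < average M (ball y s) f}"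
    have "S \<noteq> {}" using y Z by (force simp: S_def N_def)
    have "s \<le> \<sigma>" if "s \<in> S" for s
      using small[OF Gd, of y s] y u that by (force simp: S_def h_def t_def)
    then have bS: "bdd_above S" by (auto simp: bdd_above_def)
    obtain s0 where "s0 \<in> S" using \<open>S \<noteq> {}\<close> by blast
    then have "0 < Sup S" using cSup_upper[OF _ bS] by (force simp: S_def)
    then have "Sup S / 2 < Sup S" by simp
    then obtain s where s: "s \<in> S" "Sup S / 2 < s" using less_cSup_iff[OF \<open>S \<noteq> {}\<close> bS] by blast
    have "average M (ball y s') f \<le> t" if "2 * s \<le> s'" "s' \<le> h" for s'
    proof (rule ccontr)
      assume "\<not> ?thesis"
      then have "s' \<in> S" using that s by (auto simp: S_def)
      then show False using cSup_upper[OF _ bS] s that by fastforce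
    qed
    then show ?thesis using s \<open>s \<in> S \<Longrightarrow> s \<le> \<sigma>\<close> by (auto simp: S_def)
  qed
  then obtain \<rho> where \<rho>: "\<And>y. y \<in> G - Z \<Longrightarrow> 0 < \<rho> y" "\<And>y. y \<in> G - Z \<Longrightarrow> \<rho> y \<le> \<sigma>"
    "\<And>y. y \<in> G - Z \<Longrightarrow> t < average M (ball y (\<rho> y)) f"
    "\<And>y s'. y \<in> G - Z \<Longrightarrow> 2 * \<rho> y \<le> s' \<Longrightarrow> s' \<le> h \<Longrightarrow> average M (ball y s') f \<le> t" by metis
  have ball_est: "emeasure M ({v. 3 / 2 * u < f v} \<inter> ball y (3 * \<rho> y))
      \<le> ennreal k * emeasure M ({v. u < f v} \<inter> ball y (\<rho> y))" if y: "y \<in> G - Z" for y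
  proof -
    note \<rho> = \<rho>[OF y]
    have le: "3 * \<rho> y \<le> h" "\<tau> * (3 * \<rho> y) \<le> h" "2 * \<rho> y \<le> \<tau> * (3 * \<rho> y)"
    proof -
      show "3 * \<rho> y \<le> h" using \<rho> \<sigma>h by linarith
      have "\<tau> * (3 * \<rho> y) \<le> \<tau> * (3 * \<sigma>)" using \<rho> params by (intro mult_left_mono) auto
      then show "\<tau> * (3 * \<rho> y) \<le> h" using \<sigma>h by (simp add: algebra_simps)
      have "1 * (3 * \<rho> y) \<le> \<tau> * (3 * \<rho> y)" using params \<rho> by (intro mult_right_mono) auto
      then show "2 * \<rho> y \<le> \<tau> * (3 * \<rho> y)" using \<rho> by linarith
    qed
    have p3: "0 < 3 * \<rho> y" "0 < \<tau> * (3 * \<rho> y)" using \<rho> params by auto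
    have yd: "dist x y < (1 + \<eta> / 2) * r" using Gd y by auto
    \<comment> \<open>The stopping rule is used for the dilated triple: the mean of \<open>w\<close>
      there is at most \<open>t + a\<close>, so the Gurov-Reshetnyak condition bounds the
      oscillation on the triple by \<open>e\<close>.\<close>
    have "\<bar>average M (ball y (\<tau> * (3 * \<rho> y))) w - a\<bar> \<le> average M (ball y (\<tau> * (3 * \<rho> y))) f"
      unfolding f_def[abs_def] using measure_ball_pos[OF p3(2)] by (intro abs_average_diff_le w_int) auto
    also have "\<dots> \<le> t" using \<rho>(4) le by blast
    finally have "average M (ball y (\<tau> * (3 * \<rho> y))) w \<le> t + K2 * \<Lambda>" using a_le by linarith
    then have "\<epsilon> * average M (ball y (\<tau> * (3 * \<rho> y))) w \<le> e"
      using params unfolding e t_def by (intro mult_left_mono) auto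
    moreover have "ball y (\<tau> * (3 * \<rho> y)) \<subseteq> ball x (\<tau> * ((1 + \<eta>) * r))"
      using sub[OF yd le(2)] VU by blast
    ultimately have osc: "average M (ball y (3 * \<rho> y)) (\<lambda>v. \<bar>w v - average M (ball y (3 * \<rho> y)) w\<bar>) \<le> e"
      using gr_le[OF p3(1)] by (meson order_trans)
    \<comment> \<open>With \<open>s = u / 4\<close> around \<open>t = 5 / 4 * u\<close>, the two
      levels become \<open>3 / 2 * u\<close> and \<open>u\<close>, and the constant 2 becomes
      8.\<close>
    have "measure M ({v. t + u / 4 < \<bar>w v - a\<bar>} \<inter> ball y (3 * \<rho> y))
      \<le> 2 * (c * 3 powr D) * e / (u / 4) * measure M ({v. t - u / 4 < \<bar>w v - a\<bar>} \<inter> ball y (\<rho> y))"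
      using \<rho>(3) \<rho>(4)[of "3 * \<rho> y"] \<rho>(1) le u e
      by (intro good_lambda_ball w_int osc) (auto simp: f_def[abs_def])
    then have "measure M ({v. 3 / 2 * u < f v} \<inter> ball y (3 * \<rho> y))
      \<le> k * measure M ({v. u < f v} \<inter> ball y (\<rho> y))"
      by (simp add: t_def k_def f_def)
    then show ?thesis using k0
      by (simp only: emeasure_eq_measure2[OF level_set_fmeasurable] ennreal_mult[OF k0 measure_nonneg, symmetric]
          ennreal_leI)
  qed
  have "\<exists>S. countable S \<and> S \<subseteq> G - Z \<and> G - Z \<subseteq> (\<Union>y\<in>S. ball y (3 * \<rho> y)) \<and>
      (\<Union>y\<in>S. {v. 3 / 2 * u < f v} \<inter> ball y (3 * \<rho> y)) \<in> sets M \<and>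
      emeasure M (\<Union>y\<in>S. {v. 3 / 2 * u < f v} \<inter> ball y (3 * \<rho> y))
        \<le> ennreal k * emeasure M ({v. u < f v} \<inter> ball x r1)"
  proof (rule vitali_measure[of "G - Z" \<rho> x "(1 + \<eta>) * r" \<sigma> "\<lambda>y. {v. 3 / 2 * u < f v} \<inter> ball y (3 * \<rho> y)"
        "\<lambda>y. {v. u < f v} \<inter> ball y (\<rho> y)" "{v. u < f v} \<inter> ball x r1" "ennreal k"])
    fix y assume y: "y \<in> G - Z"
    show "ball y (\<rho> y) \<subseteq> ball x ((1 + \<eta>) * r)"
      using sub[OF Gd, of y "\<rho> y"] \<rho>[OF y] \<sigma>h y by (simp add: V_def)
    have "ball y (\<rho> y) \<subseteq> ball x r1"
    proof
      fix v assume "v \<in> ball y (\<rho> y)"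
      then show "v \<in> ball x r1"
        using y \<rho>(2)[OF y] r dist_triangle[of x v y] by (auto simp: G_def)
    qed
    then show "{v. u < f v} \<inter> ball y (\<rho> y) \<subseteq> {v. u < f v} \<inter> ball x r1" by blast
  qed (use \<rho> ball_est in \<open>auto\<close>)
  then obtain S where S: "G - Z \<subseteq> (\<Union>y\<in>S. ball y (3 * \<rho> y))"
     "(\<Union>y\<in>S. {v. 3 / 2 * u < f v} \<inter> ball y (3 * \<rho> y)) \<in> sets M"
     "emeasure M (\<Union>y\<in>S. {v. 3 / 2 * u < f v} \<inter> ball y (3 * \<rho> y))
        \<le> ennreal k * emeasure M ({v. u < f v} \<inter> ball x r1)" by blast
  define P where "P = (\<Union>y\<in>S. {v. 3 / 2 * u < f v} \<inter> ball y (3 * \<rho> y))"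
  note S = S[folded P_def]
  have "G \<subseteq> Z \<union> P" using S(1) by (fastforce simp: P_def G_def)
  have "emeasure M G \<le> emeasure M (Z \<union> P)"
    using \<open>G \<subseteq> Z \<union> P\<close> S Z by (intro emeasure_mono) auto
  also have "\<dots> \<le> emeasure M Z + emeasure M P"
    using S Z by (intro emeasure_subadditive) auto
  also have "\<dots> = emeasure M P" using Z by (simp add: null_setsD1)
  also note S(3)
  finally have "ennreal (measure M G) \<le> ennreal (k * measure M ({v. u < f v} \<inter> ball x r1))"
    by (simp only: emeasure_eq_measure2[OF level_set_fmeasurable] G_def ennreal_mult[OF k0 measure_nonneg, symmetric])
  then have "measure M G \<le> k * measure M ({v. u < f v} \<inter> ball x r1)"
    using k0 by (subst (asm) ennreal_le_iff) auto
  then show ?thesis by (simp only: G_def k_def)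
qed

end

subsection \<open>Iteration over the levels\<close>

text \<open>
  At the level \<open>(3/2)^k * u\<^sub>0\<close> the stopping radii are at most
  \<open>first_radius D \<tau> \<eta> * decay_ratio D ^ k * r\<close>.
  The first summand of \<open>base_level\<close> makes the good-lambda factor small, the second one yields this
  bound on the radii.
\<close>

definition decay_ratio :: "real \<Rightarrow> real" where
  "decay_ratio D = (3 / 2) powr (- 1 / D)"

definition first_radius :: "real \<Rightarrow> real \<Rightarrow> real \<Rightarrow> real" where
  "first_radius D \<tau> \<eta> = min (\<eta> * (1 - decay_ratio D) / 2) (\<eta> / (6 * \<tau>))"

definition base_level :: "real \<Rightarrow> real \<Rightarrow> real \<Rightarrow> real \<Rightarrow> real \<Rightarrow> real" where
  "base_level c D \<tau> \<eta> p =
     32 * (c * 3 powr D) * (c * (\<tau> * (1 + \<eta>)) powr D) * 2 powr p +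
     (1 + c * (1 + \<eta>) powr D) * c * ((1 + \<eta>) / first_radius D \<tau> \<eta>) powr D"

lemma decay_ratio: "0 < D \<Longrightarrow> 0 < decay_ratio D \<and> decay_ratio D < 1"
  using powr_less_mono[of "- 1 / D" 0 "3 / 2"] by (simp add: decay_ratio_def)

lemma power_powr_commute: "0 < b \<Longrightarrow> (b ^ n) powr p = (b powr p) ^ n" for b p :: real
  by (simp add: powr_powr mult.commute flip: powr_realpow)

text \<open>The ratio is chosen with \<open>D\<close>-th power 2/3: shrinking a radius by it raises
  the growth bound \<open>(r / s) powr D\<close> by exactly the quotient 3/2 of consecutive
  levels.\<close>

lemma decay_ratio_power_powr:
  assumes "0 < D"
  shows "(decay_ratio D ^ k) powr D = inverse ((3 / 2) ^ k)"
proof -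
  have "(decay_ratio D ^ k) powr D = (decay_ratio D powr D) ^ k"
    using decay_ratio[OF assms] by (simp add: power_powr_commute)
  also have "decay_ratio D powr D = inverse (3 / 2)"
    using assms unfolding decay_ratio_def powr_powr by (simp add: powr_minus_divide)
  finally show ?thesis by (simp add: power_inverse power_divide)
qed

context gr_ball
begin

context
  fixes p :: real
  assumes p: "1 \<le> p" and small: "2 powr p * (40 * (c * 3 powr D) * \<epsilon>) \<le> 1"
begin

definition "\<theta> = decay_ratio D"
definition "\<delta> = first_radius D \<tau> \<eta>"
definition "L = base_level c D \<tau> \<eta> p"
definition "C1 = c * 3 powr D"
text \<open>A bound for the good-lambda factor \<open>8 * C1 * e / u k\<close> at every level: the
  part \<open>5 / 4 * u k\<close> of \<open>e\<close> gives the first summand, and the part with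
  \<open>\<Lambda>\<close>, which weighs most at the base level, gives the second.\<close>

definition "\<gamma> = 10 * C1 * \<epsilon> + 8 * C1 * K2 / L"
definition "u k = (3 / 2) ^ k * (L * \<epsilon> * \<Lambda>)"
text \<open>The excess over \<open>r\<close> is the sum of all stopping bounds
  \<open>\<delta> * r * \<theta> ^ j\<close> with \<open>j \<ge> k\<close>, that is, the margin
  needed by the generations from \<open>k\<close> on.\<close>

definition "rad k = r * (1 + \<delta> * \<theta> ^ k / (1 - \<theta>))"
definition "m k = measure M ({v. u k < f v} \<inter> ball x (rad k))"

lemma \<theta>: "0 < \<theta>" "\<theta> < 1"
  using decay_ratio[OF D_pos] by (auto simp: \<theta>_def)

text \<open>The two entries of the minimum in \<open>first_radius\<close>: one bounds the total
  margin of all generations, the other the reach of a \<open>\<tau>\<close>-dilated triple. Each may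
  use half of \<open>\<eta>\<close>.\<close>

lemma \<delta>: "0 < \<delta>" "\<delta> / (1 - \<theta>) \<le> \<eta> / 2" "3 * \<tau> * \<delta> \<le> \<eta> / 2"
proof -
  show "0 < \<delta>" using params \<theta> by (simp add: \<delta>_def first_radius_def \<theta>_def)
  have "\<delta> \<le> \<eta> * (1 - \<theta>) / 2" by (simp add: \<delta>_def first_radius_def \<theta>_def)
  then show "\<delta> / (1 - \<theta>) \<le> \<eta> / 2" using \<theta> by (simp add: pos_divide_le_eq)
  have "\<delta> \<le> \<eta> / (6 * \<tau>)" by (simp add: \<delta>_def first_radius_def)
  then show "3 * \<tau> * \<delta> \<le> \<eta> / 2" using params by (simp add: field_simps)
qed

lemma C1_pos: "0 < C1" using c_ge_1 by (simp add: C1_def)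

lemma K_pos: "0 < K1" "0 < K2"
  using c_ge_1 params by (auto simp: K1_def K2_def add_pos_nonneg)

lemma L_eq: "L = 32 * C1 * K2 * 2 powr p + K1 * c * ((1 + \<eta>) / \<delta>) powr D"
  by (simp add: L_def base_level_def C1_def K1_def K2_def \<delta>_def)

lemma L_ge: "32 * C1 * K2 * 2 powr p \<le> L" "K1 * c * ((1 + \<eta>) / \<delta>) powr D \<le> L" "0 < L"
  using C1_pos K_pos c_ge_1 by (auto simp: L_eq add_pos_nonneg)

text \<open>After multiplication by \<open>2 powr p\<close> each summand is at most 1/4: the first
  by \<open>small\<close>, where 40 is 4 times 10, the second by the coefficient 32 = 4 * 8 in
  \<open>base_level\<close>. The bound 1/2 makes the sum over the layers geometric.\<close>

lemma \<gamma>: "0 < \<gamma>" "(3 / 2) powr p * \<gamma> \<le> 1 / 2" "\<gamma> \<le> 1 / 3"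
proof -
  show pos: "0 < \<gamma>" using C1_pos K_pos L_ge params by (simp add: \<gamma>_def add_pos_pos)
  have "2 powr p * (10 * C1 * \<epsilon>) \<le> 1 / 4" using small by (simp add: C1_def)
  moreover have "2 powr p * (8 * C1 * K2 / L) \<le> 1 / 4"
    using L_ge by (simp add: field_simps)
  ultimately have "2 powr p * \<gamma> \<le> 1 / 2" unfolding \<gamma>_def distrib_left by linarith
  moreover have "(3 / 2) powr p * \<gamma> \<le> 2 powr p * \<gamma>"
    using pos p by (intro mult_right_mono powr_mono2) auto
  ultimately show le: "(3 / 2) powr p * \<gamma> \<le> 1 / 2" by linarith
  have "(3 / 2) powr 1 \<le> (3 / 2 :: real) powr p" using p by (intro powr_mono) auto
  then have "3 / 2 * \<gamma> \<le> (3 / 2) powr p * \<gamma>" using pos by (intro mult_right_mono) auto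
  with le show "\<gamma> \<le> 1 / 3" by linarith
qed

lemma u_pos: "0 < u k"
  using L_ge params by (simp add: u_def)

lemma rad: "r \<le> rad k" "rad k \<le> (1 + \<eta> / 2) * r" "rad (Suc k) + \<delta> * r * \<theta> ^ k = rad k"
proof -
  have t: "0 \<le> \<theta> ^ k" "\<theta> ^ k \<le> 1" using \<theta> by (auto simp: power_le_one)
  have d0: "0 \<le> \<delta> / (1 - \<theta>)" using \<delta> \<theta> by simp
  have "0 \<le> \<delta> / (1 - \<theta>) * \<theta> ^ k" using d0 t(1) by (rule mult_nonneg_nonneg)
  then have "r * 1 \<le> r * (1 + \<delta> / (1 - \<theta>) * \<theta> ^ k)" using params by (intro mult_left_mono) auto
  then show "r \<le> rad k" by (simp add: rad_def)
  have "\<delta> / (1 - \<theta>) * \<theta> ^ k \<le> \<eta> / 2 * 1" using d0 t \<delta> params by (intro mult_mono) auto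
  then have "r * (1 + \<delta> / (1 - \<theta>) * \<theta> ^ k) \<le> r * (1 + \<eta> / 2)" using params by (intro mult_left_mono) auto
  then show "rad k \<le> (1 + \<eta> / 2) * r" by (simp add: rad_def mult.commute)
  show "rad (Suc k) + \<delta> * r * \<theta> ^ k = rad k" using \<theta> by (simp add: rad_def field_simps)
qed

text \<open>Supplies the hypothesis \<open>small\<close> of \<open>good_lambda_step\<close> at level
  \<open>k\<close>. The worst case is the smallest radius, where the factor
  \<open>\<theta> ^ k\<close> contributes \<open>(3 / 2) ^ k\<close> and the remaining constant is
  the second summand of \<open>L\<close>.\<close>

lemma average_f_le_u:
  assumes y: "dist x y < (1 + \<eta> / 2) * r" and s: "\<delta> * r * \<theta> ^ k < s" "s \<le> \<eta> * r / 2"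
  shows "average M (ball y s) f \<le> u k"
proof -
  have pos: "0 < \<delta> * r * \<theta> ^ k" using \<delta> \<theta> params by simp
  then have s0: "0 < s" using s by linarith
  have sub: "ball y s \<subseteq> ball x ((1 + \<eta>) * r)"
  proof
    fix v assume "v \<in> ball y s"
    then have "dist x v < (1 + \<eta> / 2) * r + \<eta> * r / 2"
      using y s dist_triangle[of x v y] by simp
    then show "v \<in> ball x ((1 + \<eta>) * r)" by (simp add: algebra_simps)
  qed
  have "0 < \<eta> * r" using params by simp
  then have "s \<le> r + \<eta> * r" using s params by linarith
  then have "s \<le> (1 + \<eta>) * r" by (simp add: algebra_simps)
  from average_f_small_ball[OF sub s0 this]
  have "average M (ball y s) f \<le> K1 * c * ((1 + \<eta>) * r / s) powr D * (\<epsilon> * \<Lambda>)" .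
  also have "\<dots> \<le> K1 * c * ((1 + \<eta>) * r / (\<delta> * r * \<theta> ^ k)) powr D * (\<epsilon> * \<Lambda>)"
    using s s0 pos params K_pos c_ge_1 D_pos
    by (intro mult_right_mono mult_left_mono powr_mono2 divide_left_mono) auto
  also have "(1 + \<eta>) * r / (\<delta> * r * \<theta> ^ k) = (1 + \<eta>) / \<delta> / \<theta> ^ k"
    using params by simp
  also have "\<dots> powr D = ((1 + \<eta>) / \<delta>) powr D * (3 / 2) ^ k"
  proof -
    have "((1 + \<eta>) / \<delta> / \<theta> ^ k) powr D = ((1 + \<eta>) / \<delta>) powr D / (\<theta> ^ k) powr D"
      by (rule powr_divide; use \<delta>(1) \<theta>(1) params(3) in simp)
    then show ?thesis
      by (simp only: \<theta>_def decay_ratio_power_powr[OF D_pos] divide_inverse inverse_inverse_eq)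
  qed
  also have "K1 * c * (((1 + \<eta>) / \<delta>) powr D * (3 / 2) ^ k) * (\<epsilon> * \<Lambda>)
      = (K1 * c * ((1 + \<eta>) / \<delta>) powr D) * ((3 / 2) ^ k * (\<epsilon> * \<Lambda>))" by simp
  also have "\<dots> \<le> L * ((3 / 2) ^ k * (\<epsilon> * \<Lambda>))"
    using L_ge params by (intro mult_right_mono) auto
  finally show ?thesis by (simp add: u_def algebra_simps)
qed

lemma m_Suc_le: "m (Suc k) \<le> \<gamma> * m k"
proof -
  define e where "e = \<epsilon> * (5 / 4 * u k + K2 * \<Lambda>)"
  \<comment> \<open>No level is below the base level; this turns the constant term of
    \<open>e\<close> into a multiple of \<open>u k\<close>.\<close>
  have "L * \<epsilon> * \<Lambda> * 1 \<le> L * \<epsilon> * \<Lambda> * (3 / 2) ^ k"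
    using L_ge params by (intro mult_left_mono) auto
  then have uL: "\<epsilon> * \<Lambda> \<le> u k / L" by (subst pos_le_divide_eq[OF L_ge(3)]) (simp add: u_def mult_ac)
  have "8 * C1 * e = 10 * C1 * \<epsilon> * u k + 8 * C1 * K2 * (\<epsilon> * \<Lambda>)"
    by (simp add: e_def algebra_simps)
  also have "\<dots> \<le> 10 * C1 * \<epsilon> * u k + 8 * C1 * K2 * (u k / L)"
    using uL C1_pos K_pos by (intro add_left_mono mult_left_mono) auto
  also have "\<dots> = \<gamma> * u k" by (simp add: \<gamma>_def algebra_simps)
  finally have e: "8 * C1 * e \<le> \<gamma> * u k" .
  also have "\<gamma> * u k \<le> 1 / 3 * u k" using \<gamma> u_pos[of k] by (intro mult_right_mono) auto
  finally have e': "3 * C1 * e \<le> u k / 4" using u_pos[of k] by simp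
  have \<sigma>: "0 < \<delta> * r * \<theta> ^ k" using \<delta> \<theta> params by simp
  have "3 * \<tau> * \<delta> * (r * \<theta> ^ k) \<le> \<eta> / 2 * (r * 1)"
    using \<delta> \<theta> params by (intro mult_mono) (auto simp: power_le_one)
  then have \<sigma>2: "3 * \<tau> * (\<delta> * r * \<theta> ^ k) \<le> \<eta> * r / 2" by (simp add: algebra_simps)
  have "m (Suc k) = measure M ({v. 3 / 2 * u k < f v} \<inter> ball x (rad (Suc k)))"
    by (simp add: m_def u_def algebra_simps)
  also have "\<dots> \<le> 8 * (c * 3 powr D) * e / u k * measure M ({v. u k < f v} \<inter> ball x (rad k))"
    using rad[of k] e' average_f_le_u u_pos \<sigma> \<sigma>2
    by (intro good_lambda_step[of _ "\<delta> * r * \<theta> ^ k"]) (auto simp: e_def C1_def)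
  also have "\<dots> \<le> \<gamma> * m k"
    using e u_pos[of k] unfolding m_def by (intro mult_right_mono) (auto simp: pos_divide_le_eq C1_def)
  finally show ?thesis .
qed

lemma m_le: "m k \<le> \<gamma> ^ k * (c * (1 + \<eta>) powr D * measure M (ball x r))"
proof (induction k)
  case 0
  have "m 0 \<le> measure M (ball x ((1 + \<eta>) * r))"
  proof -
    have "(1 + \<eta> / 2) * r \<le> (1 + \<eta>) * r" using params by (intro mult_right_mono) auto
    then have "rad 0 \<le> (1 + \<eta>) * r" using rad(2)[of 0] by linarith
    then show ?thesis unfolding m_def by (intro measure_mono_fmeasurable) auto
  qed
  also have "\<dots> \<le> c * ((1 + \<eta>) * r / r) powr D * measure M (ball x r)"
    using params r_le by (intro measure_ball_le subset_ball) auto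
  finally show ?case using params by simp
next
  case (Suc k)
  have "m (Suc k) \<le> \<gamma> * m k" by (rule m_Suc_le)
  also have "\<dots> \<le> \<gamma> * (\<gamma> ^ k * (c * (1 + \<eta>) powr D * measure M (ball x r)))"
    using Suc \<gamma> by (intro mult_left_mono) auto
  finally show ?case by (simp add: mult.assoc)
qed

text \<open>A single layer suffices: if \<open>u j < f v \<le> u (Suc j)\<close>, the term with
  index \<open>j\<close> already dominates. The other layers only enlarge the right-hand
  side.\<close>

lemma powr_f_le_layers:
  "ennreal (f v powr p) \<le> ennreal (u 0 powr p) + (\<Sum>k. ennreal (u (Suc k) powr p) * indicator {v. u k < f v} v)"
proof (cases "f v \<le> u 0")
  case True
  then have "ennreal (f v powr p) \<le> ennreal (u 0 powr p)"
    using p f_nonneg by (intro ennreal_leI powr_mono2) auto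
  then show ?thesis by (simp add: add_increasing2)
next
  case False
  obtain n where "f v / (L * \<epsilon> * \<Lambda>) < (3 / 2) ^ n"
    using real_arch_pow[of "3 / 2" "f v / (L * \<epsilon> * \<Lambda>)"] by auto
  then have "f v \<le> u n" using L_ge params by (simp add: u_def pos_divide_less_eq)
  define k where "k = (LEAST k. f v \<le> u k)"
  have k: "f v \<le> u k" unfolding k_def by (rule LeastI) fact
  with False obtain j where j: "k = Suc j" by (cases k) auto
  define F where "F k = ennreal (u (Suc k) powr p) * indicator {v. u k < f v} v" for k
  have "u j < f v" using not_less_Least[of j "\<lambda>k. f v \<le> u k"] j by (simp add: k_def)
  then have "ennreal (f v powr p) \<le> F j"
    using k j p f_nonneg by (auto simp: F_def intro!: ennreal_leI powr_mono2)
  also have "\<dots> \<le> (\<Sum>k. F k)"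
    using sum_le_suminf[OF summableI, of "{j}" F] by simp
  finally show ?thesis by (simp add: add_increasing F_def)
qed

text \<open>The power is not known to be integrable beforehand, and a non-integrable function would
  have the integral 0. The layers are therefore summed in the nonnegative integral, which yields
  integrability before the real-valued bound is read off.\<close>

lemma powr_integral_bound:
  "set_integrable M (ball x r) (\<lambda>v. f v powr p)"
  "(LINT v:ball x r|M. f v powr p)
    \<le> (L * \<epsilon> * \<Lambda>) powr p * (1 + 2 * 2 powr p * (c * (1 + \<eta>) powr D)) * measure M (ball x r)"
proof -
  define B where "B = ball x r"
  define \<mu> where "\<mu> = measure M B"
  define Q where "Q = c * (1 + \<eta>) powr D"
  define U where "U = (L * \<epsilon> * \<Lambda>) powr p"
  have Q: "0 \<le> Q" using c_ge_1 by (simp add: Q_def)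
  have [measurable]: "B \<in> sets M" by (simp add: B_def)
  have [measurable]: "{v. t < f v} \<in> sets M" for t
  proof -
    have "{v \<in> space M. t < f v} \<in> sets M" by measurable
    then show ?thesis by simp
  qed
  have layer: "ennreal (u (Suc k) powr p) * emeasure M ({v. u k < f v} \<inter> B)
      \<le> ennreal (U * 2 powr p * Q * \<mu> * (1 / 2) ^ k)" for k
  proof -
    have "emeasure M ({v. u k < f v} \<inter> B) \<le> emeasure M ({v. u k < f v} \<inter> ball x (rad k))"
      using rad(1)[of k] by (intro emeasure_mono) (auto simp: B_def)
    also have "\<dots> = ennreal (m k)"
      unfolding m_def by (rule emeasure_eq_measure2[OF level_set_fmeasurable])
    also have "\<dots> \<le> ennreal (\<gamma> ^ k * (Q * \<mu>))"
      using m_le[of k] by (intro ennreal_leI) (simp add: Q_def \<mu>_def B_def)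
    finally have "ennreal (u (Suc k) powr p) * emeasure M ({v. u k < f v} \<inter> B)
      \<le> ennreal (u (Suc k) powr p) * ennreal (\<gamma> ^ k * (Q * \<mu>))" by (rule mult_left_mono) auto
    also have "\<dots> = ennreal (u (Suc k) powr p * (\<gamma> ^ k * (Q * \<mu>)))"
      by (rule ennreal_mult'[symmetric]) auto
    also have "u (Suc k) powr p * (\<gamma> ^ k * (Q * \<mu>))
       = (U * Q * \<mu>) * ((3 / 2) powr p * ((3 / 2) powr p * \<gamma>) ^ k)"
    proof -
      have "u (Suc k) powr p = U * ((3 / 2) ^ Suc k) powr p"
        using L_ge params unfolding u_def U_def by (subst powr_mult) auto
      also have "((3 / 2) ^ Suc k) powr p = ((3 / 2 :: real) powr p) ^ Suc k"
        by (rule power_powr_commute) simp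
      finally show ?thesis by (simp add: power_mult_distrib)
    qed
    \<comment> \<open>The growth of the levels and the decay of the level sets combine to the ratio
      \<open>(3 / 2) powr p * \<gamma> \<le> 1 / 2\<close>; the geometric sum then gives the factor
      2 in the result.\<close>
    also have "ennreal \<dots> \<le> ennreal ((U * Q * \<mu>) * (2 powr p * (1 / 2) ^ k))"
      using \<gamma> Q p by (intro ennreal_leI mult_left_mono mult_mono power_mono powr_mono2)
        (auto simp: U_def \<mu>_def)
    finally show ?thesis by (simp only: mult_ac)
  qed
  define A where "A = U * 2 powr p * Q * \<mu>"
  have A: "0 \<le> A" using Q by (simp add: A_def U_def \<mu>_def)
  have sums: "(\<lambda>k. A * (1 / 2) ^ k) sums (A * 2)"
    using sums_mult[OF geometric_sums[of "1 / 2 :: real"], of A] by simp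
  have "(\<Sum>k. ennreal (u (Suc k) powr p) * emeasure M ({v. u k < f v} \<inter> B))
      \<le> (\<Sum>k. ennreal (A * (1 / 2) ^ k))"
    using layer by (intro suminf_le) (auto simp: A_def)
  also have "\<dots> = ennreal (A * 2)"
    using A by (intro suminf_ennreal_eq sums) auto
  finally have tail: "(\<Sum>k. ennreal (u (Suc k) powr p) * emeasure M ({v. u k < f v} \<inter> B)) \<le> ennreal (A * 2)" .
  have "(\<integral>\<^sup>+v. ennreal (f v powr p) * indicator B v \<partial>M)
    \<le> (\<integral>\<^sup>+v. ennreal (u 0 powr p) * indicator B v +
        (\<Sum>k. ennreal (u (Suc k) powr p) * indicator ({v. u k < f v} \<inter> B) v) \<partial>M)"
    using powr_f_le_layers by (intro nn_integral_mono) (auto simp: indicator_def)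
  also have "\<dots> = ennreal (u 0 powr p) * emeasure M B +
        (\<Sum>k. ennreal (u (Suc k) powr p) * emeasure M ({v. u k < f v} \<inter> B))"
    by (subst nn_integral_add) (auto simp: nn_integral_suminf nn_integral_cmult_indicator)
  also have "\<dots> \<le> ennreal (u 0 powr p) * emeasure M B + ennreal (A * 2)"
    using tail by (rule add_left_mono)
  also have "ennreal (u 0 powr p) * emeasure M B = ennreal (U * \<mu>)"
    using fmeasurable_ball[of x r]
    by (simp add: u_def U_def \<mu>_def B_def emeasure_eq_measure2 ennreal_mult)
  also have "ennreal (U * \<mu>) + ennreal (A * 2) = ennreal (U * \<mu> + A * 2)"
    using A by (simp add: U_def \<mu>_def)
  also have "U * \<mu> + A * 2 = U * (1 + 2 * 2 powr p * Q) * \<mu>"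
    by (simp add: A_def algebra_simps)
  also have "(\<integral>\<^sup>+v. ennreal (f v powr p) * indicator B v \<partial>M) = (\<integral>\<^sup>+v. ennreal (indicator B v *\<^sub>R f v powr p) \<partial>M)"
    by (intro nn_integral_cong) (auto simp: indicator_def)
  finally have nn: "(\<integral>\<^sup>+v. ennreal (indicator B v *\<^sub>R f v powr p) \<partial>M) \<le> ennreal (U * (1 + 2 * 2 powr p * Q) * \<mu>)" .
  have int: "integrable M (\<lambda>v. indicator B v *\<^sub>R f v powr p)"
    by (rule integrableI_nonneg) (use nn in \<open>auto intro: order.strict_trans1\<close>)
  then show "set_integrable M (ball x r) (\<lambda>v. f v powr p)"
    by (simp add: set_integrable_def B_def)
  have "ennreal (LINT v:B|M. f v powr p) \<le> ennreal (U * (1 + 2 * 2 powr p * Q) * \<mu>)"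
    using nn nn_integral_eq_integral[OF int] by (simp add: set_lebesgue_integral_def)
  then have "(LINT v:B|M. f v powr p) \<le> U * (1 + 2 * 2 powr p * Q) * \<mu>"
    using Q by (subst (asm) ennreal_le_iff) (auto simp: U_def \<mu>_def)
  then show "(LINT v:ball x r|M. f v powr p)
    \<le> (L * \<epsilon> * \<Lambda>) powr p * (1 + 2 * 2 powr p * (c * (1 + \<eta>) powr D)) * measure M (ball x r)"
    by (simp add: B_def U_def \<mu>_def Q_def)
qed

end

end

section \<open>Oscillation bound and reverse Hoelder inequality on one ball\<close>

context doubling_space
begin

definition oscillation_const :: "real \<Rightarrow> real \<Rightarrow> real \<Rightarrow> real" where
  "oscillation_const \<tau> \<eta> p = base_level c D \<tau> \<eta> p * (1 + 2 * 2 powr p * (c * (1 + \<eta>) powr D))"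

lemma oscillation_const_pos:
  assumes "1 \<le> \<tau>" "0 < \<eta>"
  shows "0 < oscillation_const \<tau> \<eta> p"
proof -
  have "0 < base_level c D \<tau> \<eta> p"
    unfolding base_level_def using c_ge_1 assms by (intro add_pos_nonneg) auto
  moreover have "0 < 1 + 2 * 2 powr p * (c * (1 + \<eta>) powr D)"
    using c_ge_1 by (intro add_pos_nonneg) auto
  ultimately show ?thesis by (simp only: oscillation_const_def mult_pos_pos)
qed

text \<open>The reverse Hoelder part follows from the oscillation part through
  \<open>w \<le> \<bar>w - a\<bar> + a\<close>, using \<open>\<epsilon> \<le> 1\<close> for the
  first term and \<open>a \<le> K2 * \<Lambda>0\<close> for the second.\<close>

lemma gurov_reshetnyak_improvement:
  fixes w :: "'a \<Rightarrow> real"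
  assumes w: "integrable M w" "AE v in M. 0 \<le> w v"
    and params: "0 < r" "1 \<le> \<tau>" "0 < \<eta>" "0 < \<epsilon>"
    and gr: "weak_gurov_reshetnyak M \<tau> \<epsilon> (ball x (\<tau> * ((1 + \<eta>) * r))) w"
    and p: "1 \<le> p" and small: "2 powr p * (40 * (c * 3 powr D) * \<epsilon>) \<le> 1"
  defines "B \<equiv> ball x r" and "\<Lambda>0 \<equiv> average M (ball x (\<tau> * ((1 + \<eta>) * r))) w"
    and "K0 \<equiv> oscillation_const \<tau> \<eta> p" and "K2 \<equiv> c * (\<tau> * (1 + \<eta>)) powr D"
  shows "set_integrable M B (\<lambda>v. \<bar>w v - average M B w\<bar> powr p)"
    and "average M B (\<lambda>v. \<bar>w v - average M B w\<bar> powr p) powr (1 / p) \<le> K0 * \<epsilon> * \<Lambda>0"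
    and "set_integrable M B (\<lambda>v. w v powr p)"
    and "average M B (\<lambda>v. w v powr p) powr (1 / p) \<le> 4 * (K0 + K2) * \<Lambda>0"
proof -
  define U where "U = ball x (\<tau> * ((1 + \<eta>) * r))"
  define a where "a = average M B w"
  define L where "L = base_level c D \<tau> \<eta> p"
  define Q where "Q = 1 + 2 * 2 powr p * (c * (1 + \<eta>) powr D)"
  have gr_ball: "gr_ball M c D w x r \<tau> \<eta> \<epsilon> \<Lambda>" if "\<Lambda>0 < \<Lambda>" "0 < \<Lambda>" for \<Lambda>
    using that w params gr by unfold_locales (auto simp: \<Lambda>0_def)
  have l0: "0 \<le> \<Lambda>0"
    unfolding \<Lambda>0_def average_def set_lebesgue_integral_def
    using w(2) by (intro mult_nonneg_nonneg integral_nonneg_AE) (auto elim!: eventually_mono)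
  interpret g: gr_ball M c D w x r \<tau> \<eta> \<epsilon> "\<Lambda>0 + 1" using l0 by (intro gr_ball) auto
  have feq: "g.f v = \<bar>w v - a\<bar>" for v by (simp add: g.f_def g.a_def a_def B_def)
  have Lpos: "0 < L" using g.L_ge(3)[OF p small] by (simp add: g.L_def[OF p small] L_def)
  have Qge: "1 \<le> Q" using c_ge_1 by (simp add: Q_def)
  have K0: "K0 = L * Q" by (simp add: K0_def oscillation_const_def L_def Q_def)
  have K0pos: "0 < K0" using oscillation_const_pos params by (simp add: K0_def)
  have K2pos: "0 < K2" using g.K_pos[OF p small] by (simp add: K2_def g.K2_def)
  have Bpos: "0 < measure M B" using params by (simp add: B_def measure_ball_pos)
  show fint: "set_integrable M B (\<lambda>v. \<bar>w v - average M B w\<bar> powr p)"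
    using g.powr_integral_bound(1)[OF p small] by (simp add: feq a_def B_def)
  define X where "X = average M B (\<lambda>v. \<bar>w v - a\<bar> powr p)"
  have X0: "0 \<le> X"
    unfolding X_def average_def set_lebesgue_integral_def
    by (intro mult_nonneg_nonneg integral_nonneg_AE) auto
  have bound: "X powr (1 / p) \<le> K0 * \<epsilon> * \<Lambda>" if "\<Lambda>0 < \<Lambda>" for \<Lambda>
  proof -
    have \<Lambda>: "0 < \<Lambda>" using that l0 by linarith
    interpret h: gr_ball M c D w x r \<tau> \<eta> \<epsilon> \<Lambda> using that \<Lambda> by (rule gr_ball)
    have "h.f v = \<bar>w v - a\<bar>" for v by (simp add: h.f_def h.a_def a_def B_def)
    then have "X \<le> (L * \<epsilon> * \<Lambda>) powr p * Q"
      using h.powr_integral_bound(2)[OF p small] Bpos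
      by (simp add: X_def average_le_iff B_def h.L_def[OF p small] L_def Q_def)
    \<comment> \<open>Since \<open>Q \<ge> 1\<close>, its \<open>p\<close>-th root may be replaced
      by \<open>Q\<close> itself, which is why \<open>oscillation_const\<close> contains no
      root.\<close>
    also have "\<dots> \<le> (L * \<epsilon> * \<Lambda>) powr p * Q powr p"
      using Qge p powr_mono[of 1 p Q] by (intro mult_left_mono) auto
    also have "\<dots> = (K0 * \<epsilon> * \<Lambda>) powr p"
      using Lpos Qge params \<Lambda> by (subst powr_mult[symmetric]) (auto simp: K0 mult_ac)
    finally show ?thesis
      using X0 p K0pos params \<Lambda> by - (rule powr_inverse_le, auto)
  qed
  \<comment> \<open>The constants do not depend on \<open>\<Lambda>\<close>, so
    \<open>\<Lambda>\<close> may decrease to \<open>\<Lambda>0\<close>; this includes the case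
    \<open>\<Lambda>0 = 0\<close>.\<close>
  have Xle: "X powr (1 / p) \<le> K0 * \<epsilon> * \<Lambda>0"
  proof -
    have "X powr (1 / p) / (K0 * \<epsilon>) \<le> \<Lambda>0"
      using bound K0pos params by - (rule dense_ge, simp add: pos_divide_le_eq mult_ac)
    then show ?thesis using K0pos params by (simp add: pos_divide_le_eq mult_ac)
  qed
  then show "average M B (\<lambda>v. \<bar>w v - average M B w\<bar> powr p) powr (1 / p) \<le> K0 * \<epsilon> * \<Lambda>0"
    by (simp add: X_def a_def)
  have "\<epsilon> \<le> 1"
  proof -
    have "1 * (1 * \<epsilon>) \<le> 2 powr p * (40 * (c * 3 powr D) * \<epsilon>)"
      using p params c_ge_1 D_pos mult_mono[of 1 c 1 "3 powr D"]
      by (intro mult_mono) (auto simp: ge_one_powr_ge_zero)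
    with small show ?thesis by linarith
  qed
  define Y where "Y = (K0 + K2) * \<Lambda>0"
  have Y0: "0 \<le> Y" using K0pos K2pos l0 by (simp add: Y_def)
  have aY: "0 \<le> a" "a \<le> Y"
  proof -
    show "0 \<le> a" using g.a_nonneg by (simp add: a_def B_def g.a_def)
    have "a / K2 \<le> \<Lambda>0"
    proof (rule dense_ge)
      fix \<Lambda> assume that: "\<Lambda>0 < \<Lambda>"
      then interpret h: gr_ball M c D w x r \<tau> \<eta> \<epsilon> \<Lambda> using l0 by (intro gr_ball) auto
      show "a / K2 \<le> \<Lambda>"
        using h.a_le K2pos by (simp add: h.a_def a_def B_def h.K2_def K2_def pos_divide_le_eq mult_ac)
    qed
    then have "a \<le> K2 * \<Lambda>0" using K2pos by (simp add: pos_divide_le_eq mult_ac)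
    then show "a \<le> Y" using K0pos l0 by (simp add: Y_def distrib_right add_increasing)
  qed
  have XY: "X \<le> Y powr p"
  proof -
    have "K0 * \<epsilon> * \<Lambda>0 \<le> K0 * 1 * \<Lambda>0"
      using \<open>\<epsilon> \<le> 1\<close> K0pos l0 by (intro mult_right_mono mult_left_mono) auto
    also have "\<dots> \<le> Y" using K2pos l0 by (simp add: Y_def distrib_right)
    finally have "X powr (1 / p) \<le> Y" using Xle by linarith
    then have "(X powr (1 / p)) powr p \<le> Y powr p" using p by (intro powr_mono2) auto
    then show ?thesis using X0 p by (simp add: powr_powr)
  qed
  \<comment> \<open>An integrable majorant of \<open>w powr p\<close>: a sum of two nonnegative
    numbers is at most twice the larger one, whose power is at most the sum of the two
    powers.\<close>
  define G where "G v = 2 powr p * (\<bar>w v - a\<bar> powr p + a powr p)" for v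
  have Gint: "set_integrable M B G"
    unfolding G_def[abs_def] using fint
    by (intro set_integrable_mult_right set_integral_add set_integrable_const_fmeasurable)
      (auto simp: a_def B_def)
  have wG: "w v powr p \<le> G v" if "0 \<le> w v" for v
  proof -
    define z where "z = max \<bar>w v - a\<bar> a"
    have "w v powr p \<le> (2 * z) powr p"
    proof (rule powr_mono2)
      have "\<bar>w v - a\<bar> \<le> z" "a \<le> z" by (simp_all add: z_def)
      then show "w v \<le> 2 * z" by linarith
    qed (use that p in auto)
    also have "\<dots> = 2 powr p * z powr p" using aY by (subst powr_mult) (auto simp: z_def)
    also have "z powr p \<le> \<bar>w v - a\<bar> powr p + a powr p" by (auto simp: z_def max_def)
    finally show ?thesis by (simp add: G_def)
  qed
  have [measurable]: "w \<in> borel_measurable M" "B \<in> sets M" using w(1) by (auto simp: B_def)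
  have "set_borel_measurable M B (\<lambda>v. w v powr p)"
    unfolding set_borel_measurable_def by measurable
  then show wint: "set_integrable M B (\<lambda>v. w v powr p)"
    using w(2) by (intro set_integrable_bound[OF Gint])
      (auto elim!: eventually_mono intro: order_trans[OF wG abs_ge_self])
  have "(LINT v:B|M. w v powr p) \<le> (LINT v:B|M. G v)"
    using w(2) wG by (intro set_integral_mono_AE wint Gint) (auto elim!: eventually_mono)
  also have "\<dots> = 2 powr p * ((LINT v:B|M. \<bar>w v - a\<bar> powr p) + a powr p * measure M B)"
    unfolding G_def using fint
    by (subst set_integral_mult_right, subst set_integral_add(2))
      (auto simp: a_def B_def set_integrable_const_fmeasurable set_integral_const_fmeasurable)
  also have "(LINT v:B|M. \<bar>w v - a\<bar> powr p) = X * measure M B"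
    unfolding X_def using Bpos by (simp add: average_mult_measure)
  also have "2 powr p * (X * measure M B + a powr p * measure M B) = 2 powr p * (X + a powr p) * measure M B"
    by (simp add: algebra_simps)
  finally have "average M B (\<lambda>v. w v powr p) \<le> 2 powr p * (X + a powr p)"
    using Bpos by (simp add: average_le_iff)
  also have "\<dots> \<le> 2 powr p * (Y powr p + Y powr p)"
    using XY aY p by (intro mult_left_mono add_mono powr_mono2) auto
  \<comment> \<open>The second factor 2 is raised to \<open>2 powr p\<close> as well, so that the
    root of the whole is the plain constant 4.\<close>
  also have "\<dots> = 2 powr p * (2 powr 1 * Y powr p)" by simp
  also have "\<dots> \<le> 2 powr p * (2 powr p * Y powr p)"
    using p by (intro mult_left_mono mult_right_mono powr_mono) auto
  also have "\<dots> = (4 * Y) powr p"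
  proof -
    have "(2 * (2 * Y)) powr p = 2 powr p * (2 powr p * Y powr p)"
      using Y0 by (simp only: powr_mult)
    then show ?thesis by simp
  qed
  finally have "average M B (\<lambda>v. w v powr p) \<le> (4 * Y) powr p" .
  moreover have "0 \<le> average M B (\<lambda>v. w v powr p)"
    unfolding average_def set_lebesgue_integral_def
    by (intro mult_nonneg_nonneg integral_nonneg_AE) auto
  ultimately have "average M B (\<lambda>v. w v powr p) powr (1 / p) \<le> 4 * Y"
    using Y0 p by - (rule powr_inverse_le, auto)
  then show "average M B (\<lambda>v. w v powr p) powr (1 / p) \<le> 4 * (K0 + K2) * \<Lambda>0"
    by (simp only: Y_def mult.assoc)
qed

text \<open>Multiplying \<open>w\<close> by the indicator of \<open>A\<close> gives a function
  integrable on the whole space without changing any average over a subset of \<open>A\<close>, so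
  the condition and the conclusions carry over.\<close>

lemma local_gurov_reshetnyak_improvement:
  fixes w :: "'a \<Rightarrow> real"
  assumes w: "set_integrable M A w" "AE v in M. v \<in> A \<longrightarrow> 0 \<le> w v" and A: "A \<in> sets M"
    and gr: "weak_gurov_reshetnyak M \<tau> \<epsilon> A w"
    and params: "0 < r" "1 \<le> \<tau>" "0 < \<eta>" "0 < \<epsilon>"
    and sub: "ball x (\<tau> * ((1 + \<eta>) * r)) \<subseteq> A"
    and p: "1 \<le> p" and small: "2 powr p * (40 * (c * 3 powr D) * \<epsilon>) \<le> 1"
  defines "B \<equiv> ball x r" and "\<Lambda>0 \<equiv> average M (ball x (\<tau> * ((1 + \<eta>) * r))) w"
    and "K0 \<equiv> oscillation_const \<tau> \<eta> p" and "K2 \<equiv> c * (\<tau> * (1 + \<eta>)) powr D"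
  shows "set_integrable M B (\<lambda>v. \<bar>w v - average M B w\<bar> powr p)"
    and "average M B (\<lambda>v. \<bar>w v - average M B w\<bar> powr p) powr (1 / p) \<le> K0 * \<epsilon> * \<Lambda>0"
    and "set_integrable M B (\<lambda>v. w v powr p)"
    and "average M B (\<lambda>v. w v powr p) powr (1 / p) \<le> 4 * (K0 + K2) * \<Lambda>0"
    and "0 \<le> \<Lambda>0"
proof -
  define w' where "w' v = indicator A v * w v" for v
  have eq: "w' v = w v" if "v \<in> A" for v using that by (simp add: w'_def)
  have w': "integrable M w'" using w(1) by (simp add: w'_def[abs_def] set_integrable_def)
  have nn: "AE v in M. 0 \<le> w' v" using w(2) by (auto simp: w'_def indicator_def elim!: eventually_mono)
  define U where "U = ball x (\<tau> * ((1 + \<eta>) * r))"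
  have UA: "U \<subseteq> A" using sub by (simp add: U_def)
  have avg: "average M E w' = average M E w" if "E \<subseteq> A" for E
    using that eq by (intro average_cong) auto
  have gr': "weak_gurov_reshetnyak M \<tau> \<epsilon> U w'"
    unfolding weak_gurov_reshetnyak_def
  proof (intro allI impI)
    fix y s :: _ assume s: "0 < s" "ball y (\<tau> * s) \<subseteq> U"
    have "s \<le> \<tau> * s" using params s mult_right_mono[of 1 \<tau> s] by simp
    then have "ball y s \<subseteq> ball y (\<tau> * s)" by (rule subset_ball)
    then have sA: "ball y (\<tau> * s) \<subseteq> A" "ball y s \<subseteq> A" using s UA by auto
    have "average M (ball y s) (\<lambda>v. \<bar>w' v - average M (ball y s) w'\<bar>)
       = average M (ball y s) (\<lambda>v. \<bar>w v - average M (ball y s) w\<bar>)"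
      using sA eq by (intro average_cong) (auto simp: avg)
    also have "\<dots> \<le> \<epsilon> * average M (ball y (\<tau> * s)) w"
      using gr s sA by (simp add: weak_gurov_reshetnyak_def)
    finally show "average M (ball y s) (\<lambda>v. \<bar>w' v - average M (ball y s) w'\<bar>)
      \<le> \<epsilon> * average M (ball y (\<tau> * s)) w'" using sA by (simp add: avg)
  qed
  have BA: "B \<subseteq> A"
  proof -
    have "r * 1 \<le> r * (\<tau> * (1 + \<eta>))"
      using params mult_mono[of 1 \<tau> 1 "1 + \<eta>"] by (intro mult_left_mono) auto
    then have "B \<subseteq> U" unfolding B_def U_def by (intro subset_ball) (simp add: mult_ac)
    then show ?thesis using UA by blast
  qed
  note res = gurov_reshetnyak_improvement[OF w' nn params gr'[unfolded U_def] p small, folded B_def K0_def K2_def U_def]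
  have l: "average M U w' = \<Lambda>0" using avg[OF UA] by (simp add: \<Lambda>0_def U_def)
  have aB: "average M B w' = average M B w" by (rule avg[OF BA])
  have c1: "average M B (\<lambda>v. \<bar>w' v - average M B w\<bar> powr p) = average M B (\<lambda>v. \<bar>w v - average M B w\<bar> powr p)"
    "average M B (\<lambda>v. w' v powr p) = average M B (\<lambda>v. w v powr p)"
    using BA eq by (auto intro!: average_cong)
  have c2: "set_integrable M B (\<lambda>v. \<bar>w' v - average M B w\<bar> powr p) = set_integrable M B (\<lambda>v. \<bar>w v - average M B w\<bar> powr p)"
    "set_integrable M B (\<lambda>v. w' v powr p) = set_integrable M B (\<lambda>v. w v powr p)"
    by (rule set_integrable_cong; use BA eq in auto)+
  show "set_integrable M B (\<lambda>v. \<bar>w v - average M B w\<bar> powr p)" using res(1) by (simp add: aB c2)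
  show "average M B (\<lambda>v. \<bar>w v - average M B w\<bar> powr p) powr (1 / p) \<le> K0 * \<epsilon> * \<Lambda>0"
    using res(2) by (simp add: aB c1 l)
  show "set_integrable M B (\<lambda>v. w v powr p)" using res(3) by (simp add: c2)
  show "average M B (\<lambda>v. w v powr p) powr (1 / p) \<le> 4 * (K0 + K2) * \<Lambda>0"
    using res(4) by (simp add: c1 l)
  show "0 \<le> \<Lambda>0"
    unfolding l[symmetric] average_def set_lebesgue_integral_def
    using nn by (intro mult_nonneg_nonneg integral_nonneg_AE) (auto elim!: eventually_mono)
qed

end

section \<open>The explicit exponent\<close>

text \<open>Exponentiating, \<open>(2 * c * m) powr p < c * \<tau> powr D / (C * \<epsilon>)\<close>
  with \<open>m = max \<tau> 3 powr D\<close>. Because \<open>\<tau> powr D \<le> m\<close> and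
  \<open>1 \<le> c * m\<close>, the factor \<open>(c * m) powr p\<close> absorbs
  \<open>c * \<tau> powr D\<close>, and only \<open>2 powr p\<close> remains.\<close>

lemma exponent_threshold:
  fixes c D C \<tau> \<epsilon> p :: real
  assumes c: "1 \<le> c" and D: "0 < D" and C: "1 \<le> C" and \<tau>: "1 \<le> \<tau>" and \<epsilon>: "0 < \<epsilon>" and p: "1 \<le> p"
    and less: "p < ln (inverse C * c * \<tau> powr D * inverse \<epsilon>) / ln (2 * c * max \<tau> 3 powr D)"
  shows "2 powr p * (C * \<epsilon>) \<le> 1"
proof -
  define m where "m = max \<tau> 3 powr D"
  have m1: "1 \<le> m" using D by (simp add: m_def ge_one_powr_ge_zero)
  have mt: "\<tau> powr D \<le> m" unfolding m_def using D \<tau> by (intro powr_mono2) auto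
  have cm: "1 \<le> c * m" using c m1 mult_mono[of 1 c 1 m] by simp
  then have "0 < ln (2 * c * m)" by (simp add: mult.assoc)
  then have "p * ln (2 * c * m) < ln (inverse C * c * \<tau> powr D * inverse \<epsilon>)"
    using less by (simp add: m_def pos_less_divide_eq)
  then have "ln ((2 * c * m) powr p) < ln (inverse C * c * \<tau> powr D * inverse \<epsilon>)"
    using cm by (simp add: ln_powr)
  then have "(2 * c * m) powr p < inverse C * c * \<tau> powr D * inverse \<epsilon>"
    using cm c C \<tau> \<epsilon> by (subst (asm) ln_less_cancel_iff) auto
  also have "\<dots> = c * \<tau> powr D / (C * \<epsilon>)" by (simp add: field_simps)
  finally have "(2 * (c * m)) powr p * (C * \<epsilon>) < c * \<tau> powr D"
    using C \<epsilon> by (simp add: pos_less_divide_eq mult.assoc)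
  moreover have "c * \<tau> powr D \<le> c * m" using c by (intro mult_left_mono mt) simp
  moreover have "(2 * (c * m)) powr p = 2 powr p * (c * m) powr p" using cm by (simp only: powr_mult)
  ultimately have "2 powr p * (c * m) powr p * (C * \<epsilon>) \<le> c * m" by simp
  also have "\<dots> \<le> (c * m) powr p" using cm p powr_mono[of 1 p "c * m"] by simp
  finally have "(2 powr p * (C * \<epsilon>)) * (c * m) powr p \<le> 1 * (c * m) powr p" by (simp add: mult_ac)
  then show ?thesis using cm by (subst (asm) mult_le_cancel_right_pos) auto
qed

lemma exponent_gt_1:
  fixes c D C \<tau> \<epsilon> :: real
  assumes c: "1 \<le> c" and D: "0 < D" and C: "1 \<le> C" and \<tau>: "1 \<le> \<tau>" and \<epsilon>: "0 < \<epsilon>"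
    and less: "\<epsilon> < 1 / (2 * C) * min 1 (\<tau> / 3) powr D"
  shows "1 < ln (inverse C * c * \<tau> powr D * inverse \<epsilon>) / ln (2 * c * max \<tau> 3 powr D)"
proof -
  define m where "m = max \<tau> 3 powr D"
  have m1: "1 \<le> m" using D by (simp add: m_def ge_one_powr_ge_zero)
  have cm: "1 \<le> c * m" using c m1 mult_mono[of 1 c 1 m] by simp
  \<comment> \<open>This identity turns the admissible range of \<open>\<epsilon>\<close> into
    exactly the comparison of the arguments of the two logarithms.\<close>
  have "min 1 (\<tau> / 3) = \<tau> / max \<tau> 3" using \<tau> by (auto simp: min_def max_def)
  then have mm: "min 1 (\<tau> / 3) powr D = \<tau> powr D / m" using \<tau> by (simp add: m_def powr_divide)
  have "\<epsilon> < \<tau> powr D / (2 * C * m)" using less by (simp add: mm)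
  then have "2 * c * m < inverse C * c * \<tau> powr D * inverse \<epsilon>"
    using c C m1 \<epsilon> by (simp add: field_simps)
  then have "ln (2 * c * m) < ln (inverse C * c * \<tau> powr D * inverse \<epsilon>)"
    using cm c C \<tau> \<epsilon> by (subst ln_less_cancel_iff) auto
  moreover have "0 < ln (2 * c * m)" using cm by (simp add: mult.assoc)
  ultimately show ?thesis by (simp add: m_def)
qed

lemma exponent_at_top:
  fixes A B :: real
  assumes "0 < A" "0 < B"
  shows "filterlim (\<lambda>\<epsilon>. ln (A * inverse \<epsilon>) / B) at_top (at_right 0)"
proof -
  have "filterlim (\<lambda>\<epsilon>::real. A * inverse \<epsilon>) at_top (at_right 0)"
    by (rule filterlim_tendsto_pos_mult_at_top[OF tendsto_const assms(1) filterlim_inverse_at_top_right])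
  then have "filterlim (\<lambda>\<epsilon>. ln (A * inverse \<epsilon>)) at_top (at_right 0)"
    by (rule filterlim_compose[OF ln_at_top])
  then have "filterlim (\<lambda>\<epsilon>. inverse B * ln (A * inverse \<epsilon>)) at_top (at_right 0)"
    by (intro filterlim_tendsto_pos_mult_at_top[OF tendsto_const]) (use assms in auto)
  then show ?thesis by (simp add: divide_inverse mult.commute)
qed

theorem theorem7p10:
  fixes M :: "'a::metric_space measure" and c\<^sub>\<mu> D :: real
  assumes "doubling_measure M"
    and "D > 0"
    and "growth_bound M c\<^sub>\<mu> D"
  shows
    "\<exists>C\<^sub>\<mu>::real. C\<^sub>\<mu> \<ge> 1 \<and>
      (\<forall>\<eta>>0. \<forall>\<tau>\<ge>1. \<exists>P :: real \<Rightarrow> real.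
        (\<forall>\<epsilon>. 0 < \<epsilon> \<and> \<epsilon> < 1 / (2 * C\<^sub>\<mu>) * min 1 (\<tau> / 3) powr D \<longrightarrow>
           P \<epsilon> = ln (inverse C\<^sub>\<mu> * c\<^sub>\<mu> * \<tau> powr D * inverse \<epsilon>) / ln (2 * c\<^sub>\<mu> * max \<tau> 3 powr D) \<and>
           P \<epsilon> > 1) \<and>
        filterlim P at_top (at_right 0) \<and>
        (\<forall>p\<ge>1. \<exists>K>0.
          \<forall>\<epsilon> (x\<^sub>0::'a) r\<^sub>0 (w::'a \<Rightarrow> real).
            0 < \<epsilon> \<and> \<epsilon> < 1 / (2 * C\<^sub>\<mu>) * min 1 (\<tau> / 3) powr D \<and> p < P \<epsilon> \<and>
            0 < r\<^sub>0 \<and>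
            set_integrable M (ball x\<^sub>0 (\<tau> * ((1 + \<eta>) * r\<^sub>0))) w \<and>
            (AE y in M. y \<in> ball x\<^sub>0 (\<tau> * ((1 + \<eta>) * r\<^sub>0)) \<longrightarrow> 0 \<le> w y) \<and>
            weak_gurov_reshetnyak M \<tau> \<epsilon> (ball x\<^sub>0 (\<tau> * ((1 + \<eta>) * r\<^sub>0))) w
            \<longrightarrow>
            (\<forall>x r. 0 < r \<and> ball x (\<tau> * ((1 + \<eta>) * r)) \<subseteq> ball x\<^sub>0 (\<tau> * ((1 + \<eta>) * r\<^sub>0)) \<longrightarrow>
               set_integrable M (ball x r) (\<lambda>y. \<bar>w y - average M (ball x r) w\<bar> powr p) \<and>
               average M (ball x r) (\<lambda>y. \<bar>w y - average M (ball x r) w\<bar> powr p) powr (1 / p)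
                 \<le> K * \<epsilon> * average M (ball x (\<tau> * ((1 + \<eta>) * r))) w \<and>
               set_integrable M (ball x r) (\<lambda>y. w y powr p) \<and>
               average M (ball x r) (\<lambda>y. w y powr p) powr (1 / p)
                 \<le> K * average M (ball x (\<tau> * ((1 + \<eta>) * r))) w)))"
proof -
  interpret doubling_space M c\<^sub>\<mu> D
    using assms by unfold_locales (auto simp: doubling_measure_def)
  \<comment> \<open>The coefficient of \<open>\<epsilon>\<close> in the smallness condition of the
    iteration; it is free of \<open>\<eta>\<close>, \<open>\<tau>\<close> and
    \<open>p\<close>.\<close>
  define C where "C = 40 * (c\<^sub>\<mu> * 3 powr D)"
  have "1 \<le> 3 powr D" using assms(2) by (simp add: ge_one_powr_ge_zero)
  then have C: "1 \<le> C" using c_ge_1 mult_mono[of 1 c\<^sub>\<mu> 1 "3 powr D"] by (simp add: C_def)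
  define P where "P \<tau> \<epsilon> = ln (inverse C * c\<^sub>\<mu> * \<tau> powr D * inverse \<epsilon>) / ln (2 * c\<^sub>\<mu> * max \<tau> 3 powr D)"
    for \<tau> \<epsilon>
  show ?thesis
  proof (intro exI[of _ C] conjI[OF C] allI impI, goal_cases)
    case (1 \<eta> \<tau>)
    then have \<eta>: "0 < \<eta>" and \<tau>: "1 \<le> \<tau>" by auto
    have cm: "1 \<le> c\<^sub>\<mu> * max \<tau> 3 powr D"
      using c_ge_1 mult_mono[of 1 c\<^sub>\<mu> 1 "max \<tau> 3 powr D"] assms(2) by (simp add: ge_one_powr_ge_zero)
    have lim: "filterlim (P \<tau>) at_top (at_right 0)"
      unfolding P_def using C c_ge_1 \<tau> cm
      by (intro exponent_at_top) (auto simp: mult.assoc)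
    define K2 where "K2 = c\<^sub>\<mu> * (\<tau> * (1 + \<eta>)) powr D"
    have K2: "0 < K2" using c_ge_1 \<eta> \<tau> by (simp add: K2_def)
    have bounds: "set_integrable M (ball x r) (\<lambda>y. \<bar>w y - average M (ball x r) w\<bar> powr p) \<and>
        average M (ball x r) (\<lambda>y. \<bar>w y - average M (ball x r) w\<bar> powr p) powr (1 / p)
          \<le> 4 * (oscillation_const \<tau> \<eta> p + K2) * \<epsilon> * average M (ball x (\<tau> * ((1 + \<eta>) * r))) w \<and>
        set_integrable M (ball x r) (\<lambda>y. w y powr p) \<and>
        average M (ball x r) (\<lambda>y. w y powr p) powr (1 / p)
          \<le> 4 * (oscillation_const \<tau> \<eta> p + K2) * average M (ball x (\<tau> * ((1 + \<eta>) * r))) w"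
      if p: "1 \<le> p" and \<epsilon>: "0 < \<epsilon>" "p < P \<tau> \<epsilon>"
        and w: "set_integrable M A w" "AE y in M. y \<in> A \<longrightarrow> 0 \<le> w y" "A \<in> sets M"
          "weak_gurov_reshetnyak M \<tau> \<epsilon> A w"
        and x: "0 < r" "ball x (\<tau> * ((1 + \<eta>) * r)) \<subseteq> A"
      for p \<epsilon> A w x r
    proof -
      have "2 powr p * (40 * (c\<^sub>\<mu> * 3 powr D) * \<epsilon>) \<le> 1"
        using exponent_threshold[OF c_ge_1 assms(2) C \<tau> \<epsilon>(1) p] \<epsilon>(2) by (simp add: P_def C_def)
      note res = local_gurov_reshetnyak_improvement[OF w x(1) \<tau> \<eta> \<epsilon>(1) x(2) p this, folded K2_def]
      let ?l = "average M (ball x (\<tau> * ((1 + \<eta>) * r))) w"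
      have K: "oscillation_const \<tau> \<eta> p \<le> 4 * (oscillation_const \<tau> \<eta> p + K2)"
        using K2 oscillation_const_pos[OF \<tau> \<eta>, of p] by simp
      have "oscillation_const \<tau> \<eta> p * \<epsilon> * ?l \<le> 4 * (oscillation_const \<tau> \<eta> p + K2) * \<epsilon> * ?l"
        using K \<epsilon> res(5) by (intro mult_right_mono) auto
      with res show ?thesis by auto
    qed
    show ?case
    proof (intro exI[of _ "P \<tau>"] conjI[OF _ conjI[OF lim]] allI impI, goal_cases)
      case (1 \<epsilon>)
      then show ?case
        using exponent_gt_1[OF c_ge_1 assms(2) C \<tau>, of \<epsilon>] by (simp add: P_def)
    next
      case (2 p)
      \<comment> \<open>One constant for both inequalities. It is fixed before
        \<open>\<epsilon>\<close>, the weight and the balls, and involves only \<open>p\<close>,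
        \<open>\<tau>\<close>, \<open>\<eta>\<close> and the growth constants.\<close>
      have K: "0 < 4 * (oscillation_const \<tau> \<eta> p + K2)" using K2 oscillation_const_pos[OF \<tau> \<eta>, of p] by simp
      show ?case
      proof (intro exI[of _ "4 * (oscillation_const \<tau> \<eta> p + K2)"] conjI[OF K] allI impI, goal_cases)
        case (1 \<epsilon> x\<^sub>0 r\<^sub>0 w x r)
        then show ?case
          by (intro bounds[OF 2, where A = "ball x\<^sub>0 (\<tau> * ((1 + \<eta>) * r\<^sub>0))"]) auto
      qed
    qed
  qed
qed

end
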